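(* Let $\mathbb{F}$ be a field with $\mathrm{Char}(\mathbb{F})\neq 2,3$. The representatives of isomorphism classes of pairs $(\mathbb{A},\sigma)$, where $\mathbb{A}$ is a (non-trivial) two-dimensional associative algebra over $\mathbb{F}$ and $\sigma:\mathbb{A}\times\mathbb{A}\to\mathbb{F}$ is a non-degenerate bilinear form, are the following (that is, every such pair is isomorphic to one of the listed pairs, unique up to the identifications indicated by $\simeq$): 1. $\left(A_3(1,0,0),\begin{pmatrix}a&1\\ c&d\end{pmatrix}\right)$, where $a,c,d\in\mathbb{F}$, $ad-c\neq0$; 2. $\left(A_3(1,0,0),\begin{pmatrix}a&0\\ 1&d\end{pmatrix}\right)$, where $a,d\in\mathbb{F}$, $ad\neq0$; 3. $\left(A_3(1,0,0),\begin{pmatrix}a&0\\ 0&d\end{pmatrix}\right)\simeq\left(A_3(1,0,0),\begin{pmatrix}a&0\\ 0&t^2d\end{pmatrix}\right)$, where $a,d,t\in\mathbb{F}$, $ad\neq0$, $t\neq0$; 4. $\left(A_3(1,0,1),\begin{pmatrix}a&0\\ 1&d\end{pmatrix}\right)$, where $a,d\in\mathbb{F}$, $ad\neq0$; 5. $\left(A_3(1,0,1),\begin{pmatrix}a&0\\ 0&d\end{pmatrix}\right)\simeq\left(A_3(1,0,1),\begin{pmatrix}a&0\\ 0&t^2d\end{pmatrix}\right)$, where $a,d,t\in\mathbb{F}$, $ad\neq0$, $t\neq0$; 6. $\left(A_3(1,0,1),\begin{pmatrix}0&1\\ c&0\end{pmatrix}\right)$, where $c\in\mathbb{F}$, $c\neq0$,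 $c+1\neq0$; 7. $\left(A_3(1,0,1),\begin{pmatrix}a&1\\ -1&0\end{pmatrix}\right)$, where $a\in\mathbb{F}$; 8. $\left(A_3(\frac12,0,0),\begin{pmatrix}a&0\\ 1&d\end{pmatrix}\right)$, where $a,d\in\mathbb{F}$, $ad\neq0$; 9. $\left(A_3(\frac12,0,0),\begin{pmatrix}a&0\\ 0&d\end{pmatrix}\right)\simeq\left(A_3(\frac12,0,0),\begin{pmatrix}a&0\\ 0&t^2d\end{pmatrix}\right)$, where $a,d,t\in\mathbb{F}$, $ad\neq0$, $t\neq0$; 10. $\left(A_3(\frac12,0,0),\begin{pmatrix}0&1\\ c&0\end{pmatrix}\right)$, where $c\in\mathbb{F}$, $c\neq0$, $c+1\neq0$; 11. $\left(A_3(\frac12,0,0),\begin{pmatrix}a&1\\ -1&0\end{pmatrix}\right)$, where $a\in\mathbb{F}$; 12. $\left(A_3(\frac12,0,\frac12),\begin{pmatrix}a&1\\ c&d\end{pmatrix}\right)$, where $a,c,d\in\mathbb{F}$, $ad-c\neq0$; 13. $\left(A_3(\frac12,0,\frac12),\begin{pmatrix}a&0\\ 1&d\end{pmatrix}\right)$, where $a,d\in\mathbb{F}$, $ad\neq0$; 14. $\left(A_3(\frac12,0,\frac12),\begin{pmatrix}a&0\\ 0&d\end{pmatrix}\right)\simeq\left(A_3(\frac12,0,\frac12),\begin{pmatrix}a&0\\ 0&t^2d\end{pmatrix}\right)$, where $a,d,t\in\mathbb{F}$, $ad\neq0$, $t\neq0$; 15. $\left(A_3(\frac12,\alpha_4,\frac12),\begin{pmatrix}a&b\\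 c&d\end{pmatrix}\right)\simeq\left(A_3(\frac12,\alpha_4,\frac12),\begin{pmatrix}a&-b\\ -c&d\end{pmatrix}\right)$, where $\alpha_4,a,b,c,d\in\mathbb{F}$, $\alpha_4\neq0$, $ad-bc\neq0$; 16. $\left(A_{13},\begin{pmatrix}a&0\\ c&d\end{pmatrix}\right)\simeq\left(A_{13},\begin{pmatrix}p^2a&0\\ p^3c&p^4d\end{pmatrix}\right)$, where $a,c,d,p\in\mathbb{F}$, $ad\neq0$, $p\neq0$; 17. $\left(A_{13},\begin{pmatrix}0&b\\ c&0\end{pmatrix}\right)\simeq\left(A_{13},\begin{pmatrix}0&p^3b\\ p^3c&0\end{pmatrix}\right)$, where $b,c,p\in\mathbb{F}$, $bc\neq0$, $b+c\neq0$, $p\neq0$; 18. $\left(A_{13},\begin{pmatrix}a&b\\ -b&0\end{pmatrix}\right)\simeq\left(A_{13},\begin{pmatrix}p^2a&p^3b\\ -p^3b&0\end{pmatrix}\right)$, where $a,b,p\in\mathbb{F}$, $b^2\neq0$, $p\neq0$.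
   Context: A two-dimensional algebra over $\mathbb{F}$ with basis $(e_1,e_2)$ is given by its matrix of structure constants $\begin{pmatrix}\alpha_1&\alpha_2&\alpha_3&\alpha_4\\ \beta_1&\beta_2&\beta_3&\beta_4\end{pmatrix}$, meaning $e_1e_1=\alpha_1e_1+\beta_1e_2$, $e_1e_2=\alpha_2e_1+\beta_2e_2$, $e_2e_1=\alpha_3e_1+\beta_3e_2$, $e_2e_2=\alpha_4e_1+\beta_4e_2$. A bilinear form $\sigma$ is given by its matrix $S$ via $\sigma(x,y)=x^TSy$ in coordinates with respect to $(e_1,e_2)$. Algebras are not required to be unital; an algebra is non-trivial if its multiplication is not identically zero. Pairs $(\mathbb{A},\sigma)$ and $(\mathbb{B},\tau)$ are isomorphic if there is an algebra isomorphism $f:\mathbb{A}\to\mathbb{B}$ with $\sigma(x,y)=\tau(f(x),f(y))$ for all $x,y\in\mathbb{A}$. Algebras: $A_3(1,0,0)=\begin{pmatrix}1&0&0&0\\ 0&0&0&0\end{pmatrix}$, $A_3(1,0,1)=\begin{pmatrix}1&0&0&0\\ 0&1&0&0\end{pmatrix}$, $A_3(\frac12,0,0)=\begin{pmatrix}\frac12&0&0&0\\ 0&0&\frac12&0\end{pmatrix}$, $A_3(\frac12,\alpha_4,\frac12)=\begin{pmatrix}\frac12&0&0&\alpha_4\\ 0&\frac12&\frac12&0\end{pmatrix}$, $A_{13}=\begin{pmatrix}0&0&0&0\\ 1&0&0&0\end{pmatrix}$. Convention on algebra parameters: $A_3(\frac12,\alpha_4,\frac12)\cong A_3(\frac12,r^2\alpha_4,\frac12)$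 for $r\neq0$; in the list, $\alpha_4$ is understood up to this isomorphism, i.e. it runs over a fixed set of representatives, one for each class of isomorphic algebras in the family. *)

theory Defs
  imports "HOL-Analysis.Analysis"
begin

section \<open>Algebras with a bilinear form over an arbitrary field\<close>

text \<open>
  The underlying vector space of an abstract algebra is a whole type \<open>'v\<close>, equipped with a scalar
  multiplication by elements of the field \<open>'a\<close>. Algebras need not be unital.
\<close>

definition bilinear_map ::
  "('a::field \<Rightarrow> 'u::ab_group_add \<Rightarrow> 'u) \<Rightarrow> ('a \<Rightarrow> 'w::ab_group_add \<Rightarrow> 'w) \<Rightarrow> ('u \<Rightarrow> 'u \<Rightarrow> 'w) \<Rightarrow> bool"
  where
  "bilinear_map s s' f \<longleftrightarrow>
     (\<forall>x. Vector_Spaces.linear s s' (\<lambda>y. f x y)) \<and> (\<forall>y. Vector_Spaces.linear s s' (\<lambda>x. f x y))"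

definition two_dim_assoc_algebra ::
  "('a::field \<Rightarrow> 'v::ab_group_add \<Rightarrow> 'v) \<Rightarrow> ('v \<Rightarrow> 'v \<Rightarrow> 'v) \<Rightarrow> bool" where
  "two_dim_assoc_algebra s m \<longleftrightarrow>
     vector_space s \<and> vector_space.dim s UNIV = 2 \<and>
     bilinear_map s s m \<and> (\<forall>x y z. m (m x y) z = m x (m y z))"

definition nontrivial_mult :: "('v::zero \<Rightarrow> 'v \<Rightarrow> 'v) \<Rightarrow> bool" where
  "nontrivial_mult m \<longleftrightarrow> (\<exists>x y. m x y \<noteq> 0)"

definition nondegenerate_bilinear_form ::
  "('a::field \<Rightarrow> 'v::ab_group_add \<Rightarrow> 'v) \<Rightarrow> ('v \<Rightarrow> 'v \<Rightarrow> 'a) \<Rightarrow> bool" where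
  "nondegenerate_bilinear_form s \<sigma> \<longleftrightarrow>
     bilinear_map s (*) \<sigma> \<and>
     (\<forall>x. (\<forall>y. \<sigma> x y = 0) \<longrightarrow> x = 0) \<and> (\<forall>y. (\<forall>x. \<sigma> x y = 0) \<longrightarrow> y = 0)"

definition assoc_form_pair ::
  "('a::field \<Rightarrow> 'v::ab_group_add \<Rightarrow> 'v) \<Rightarrow> ('v \<Rightarrow> 'v \<Rightarrow> 'v) \<Rightarrow> ('v \<Rightarrow> 'v \<Rightarrow> 'a) \<Rightarrow> bool" where
  "assoc_form_pair s m \<sigma> \<longleftrightarrow>
     two_dim_assoc_algebra s m \<and> nontrivial_mult m \<and> nondegenerate_bilinear_form s \<sigma>"

definition algebra_isomorphism ::
  "('a::field \<Rightarrow> 'v::ab_group_add \<Rightarrow> 'v) \<Rightarrow> ('v \<Rightarrow> 'v \<Rightarrow> 'v) \<Rightarrow>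
   ('a \<Rightarrow> 'w::ab_group_add \<Rightarrow> 'w) \<Rightarrow> ('w \<Rightarrow> 'w \<Rightarrow> 'w) \<Rightarrow> ('v \<Rightarrow> 'w) \<Rightarrow> bool" where
  "algebra_isomorphism s m s' m' f \<longleftrightarrow>
     Vector_Spaces.linear s s' f \<and> bij f \<and> (\<forall>x y. f (m x y) = m' (f x) (f y))"

definition pairs_isomorphic ::
  "('a::field \<Rightarrow> 'v::ab_group_add \<Rightarrow> 'v) \<Rightarrow> ('v \<Rightarrow> 'v \<Rightarrow> 'v) \<Rightarrow> ('v \<Rightarrow> 'v \<Rightarrow> 'a) \<Rightarrow>
   ('a \<Rightarrow> 'w::ab_group_add \<Rightarrow> 'w) \<Rightarrow> ('w \<Rightarrow> 'w \<Rightarrow> 'w) \<Rightarrow> ('w \<Rightarrow> 'w \<Rightarrow> 'a) \<Rightarrow> bool" where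
  "pairs_isomorphic s m \<sigma> s' m' \<tau> \<longleftrightarrow>
     (\<exists>f. algebra_isomorphism s m s' m' f \<and> (\<forall>x y. \<sigma> x y = \<tau> (f x) (f y)))"

section \<open>Structure constants and Gram matrices\<close>

text \<open>
  Multiplication on \<open>'a^2\<close> with matrix of structure constants \<open>A\<close>: the columns of \<open>A\<close> hold the
  coordinates of \<open>e1 e1\<close>, \<open>e1 e2\<close>, \<open>e2 e1\<close>, \<open>e2 e2\<close>, in this order, so the product of \<open>x\<close> and \<open>y\<close>
  is \<open>A\<close> applied to the Kronecker product of \<open>x\<close> and \<open>y\<close>.
\<close>

definition sc_mult :: "'a::field^4^2 \<Rightarrow> 'a^2 \<Rightarrow> 'a^2 \<Rightarrow> 'a^2" where
  "sc_mult A x y = A *v vector [x$1 * y$1, x$1 * y$2, x$2 * y$1, x$2 * y$2]"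

definition gram_form :: "'a::field^2^2 \<Rightarrow> 'a^2 \<Rightarrow> 'a^2 \<Rightarrow> 'a" where
  "gram_form S x y = (\<Sum>i\<in>UNIV. x$i * (S *v y)$i)"

definition mat22 :: "'a::field \<Rightarrow> 'a \<Rightarrow> 'a \<Rightarrow> 'a \<Rightarrow> 'a^2^2" where
  "mat22 a b c d = vector [vector [a, b], vector [c, d]]"

definition A3_1_0_0 :: "'a::field^4^2" where
  "A3_1_0_0 = vector [vector [1, 0, 0, 0],
                      vector [0, 0, 0, 0]]"

definition A3_1_0_1 :: "'a::field^4^2" where
  "A3_1_0_1 = vector [vector [1, 0, 0, 0],
                      vector [0, 1, 0, 0]]"

definition A3_half_0_0 :: "'a::field^4^2" where
  "A3_half_0_0 = vector [vector [1/2, 0, 0, 0],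
                         vector [0, 0, 1/2, 0]]"

definition A3_half_half :: "'a::field \<Rightarrow> 'a^4^2" where
  "A3_half_half \<alpha>4 = vector [vector [1/2, 0, 0, \<alpha>4],
                             vector [0, 1/2, 1/2, 0]]"

definition A13 :: "'a::field^4^2" where
  "A13 = vector [vector [0, 0, 0, 0],
                 vector [1, 0, 0, 0]]"

text \<open>
  A set of parameters containing exactly one representative for each class of isomorphic algebras
  in the family \<open>A_3(1/2, \<alpha>4, 1/2)\<close>.
\<close>

definition alpha4_representatives :: "'a::field set \<Rightarrow> bool" where
  "alpha4_representatives R \<longleftrightarrow>
     (\<forall>\<alpha>. \<exists>!r. r \<in> R \<and>
        (\<exists>f. algebra_isomorphism (*s) (sc_mult (A3_half_half \<alpha>)) (*s) (sc_mult (A3_half_half r)) f))"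

section \<open>The list of pairs and the identifications among them\<close>

inductive_set canonical_pairs :: "'a::field set \<Rightarrow> (('a^4^2) \<times> ('a^2^2)) set" for R :: "'a set" where
  c1: "a * d - c \<noteq> 0 \<Longrightarrow> (A3_1_0_0, mat22 a 1 c d) \<in> canonical_pairs R"
| c2: "a * d \<noteq> 0 \<Longrightarrow> (A3_1_0_0, mat22 a 0 1 d) \<in> canonical_pairs R"
| c3: "a * d \<noteq> 0 \<Longrightarrow> (A3_1_0_0, mat22 a 0 0 d) \<in> canonical_pairs R"
| c4: "a * d \<noteq> 0 \<Longrightarrow> (A3_1_0_1, mat22 a 0 1 d) \<in> canonical_pairs R"
| c5: "a * d \<noteq> 0 \<Longrightarrow> (A3_1_0_1, mat22 a 0 0 d) \<in> canonical_pairs R"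
| c6: "c \<noteq> 0 \<Longrightarrow> c + 1 \<noteq> 0 \<Longrightarrow> (A3_1_0_1, mat22 0 1 c 0) \<in> canonical_pairs R"
| c7: "(A3_1_0_1, mat22 a 1 (-1) 0) \<in> canonical_pairs R"
| c8: "a * d \<noteq> 0 \<Longrightarrow> (A3_half_0_0, mat22 a 0 1 d) \<in> canonical_pairs R"
| c9: "a * d \<noteq> 0 \<Longrightarrow> (A3_half_0_0, mat22 a 0 0 d) \<in> canonical_pairs R"
| c10: "c \<noteq> 0 \<Longrightarrow> c + 1 \<noteq> 0 \<Longrightarrow> (A3_half_0_0, mat22 0 1 c 0) \<in> canonical_pairs R"
| c11: "(A3_half_0_0, mat22 a 1 (-1) 0) \<in> canonical_pairs R"
| c12: "a * d - c \<noteq> 0 \<Longrightarrow> (A3_half_half 0, mat22 a 1 c d) \<in> canonical_pairs R"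
| c13: "a * d \<noteq> 0 \<Longrightarrow> (A3_half_half 0, mat22 a 0 1 d) \<in> canonical_pairs R"
| c14: "a * d \<noteq> 0 \<Longrightarrow> (A3_half_half 0, mat22 a 0 0 d) \<in> canonical_pairs R"
| c15: "\<alpha>4 \<in> R \<Longrightarrow> \<alpha>4 \<noteq> 0 \<Longrightarrow> a * d - b * c \<noteq> 0 \<Longrightarrow>
          (A3_half_half \<alpha>4, mat22 a b c d) \<in> canonical_pairs R"
| c16: "a * d \<noteq> 0 \<Longrightarrow> (A13, mat22 a 0 c d) \<in> canonical_pairs R"
| c17: "b * c \<noteq> 0 \<Longrightarrow> b + c \<noteq> 0 \<Longrightarrow> (A13, mat22 0 b c 0) \<in> canonical_pairs R"
| c18: "b\<^sup>2 \<noteq> 0 \<Longrightarrow> (A13, mat22 a b (-b) 0) \<in> canonical_pairs R"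

text \<open>Each rule relates the two sides of one \<open>\<simeq>\<close> in the list.\<close>

inductive identified :: "('a::field^4^2) \<times> ('a^2^2) \<Rightarrow> ('a^4^2) \<times> ('a^2^2) \<Rightarrow> bool" where
  i3: "a * d \<noteq> 0 \<Longrightarrow> t \<noteq> 0 \<Longrightarrow>
         identified (A3_1_0_0, mat22 a 0 0 d) (A3_1_0_0, mat22 a 0 0 (t\<^sup>2 * d))"
| i5: "a * d \<noteq> 0 \<Longrightarrow> t \<noteq> 0 \<Longrightarrow>
         identified (A3_1_0_1, mat22 a 0 0 d) (A3_1_0_1, mat22 a 0 0 (t\<^sup>2 * d))"
| i9: "a * d \<noteq> 0 \<Longrightarrow> t \<noteq> 0 \<Longrightarrow>
         identified (A3_half_0_0, mat22 a 0 0 d) (A3_half_0_0, mat22 a 0 0 (t\<^sup>2 * d))"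
| i14: "a * d \<noteq> 0 \<Longrightarrow> t \<noteq> 0 \<Longrightarrow>
         identified (A3_half_half 0, mat22 a 0 0 d) (A3_half_half 0, mat22 a 0 0 (t\<^sup>2 * d))"
| i15: "\<alpha>4 \<noteq> 0 \<Longrightarrow> a * d - b * c \<noteq> 0 \<Longrightarrow>
         identified (A3_half_half \<alpha>4, mat22 a b c d) (A3_half_half \<alpha>4, mat22 a (-b) (-c) d)"
| i16: "a * d \<noteq> 0 \<Longrightarrow> p \<noteq> 0 \<Longrightarrow>
         identified (A13, mat22 a 0 c d) (A13, mat22 (p^2 * a) 0 (p^3 * c) (p^4 * d))"
| i17: "b * c \<noteq> 0 \<Longrightarrow> b + c \<noteq> 0 \<Longrightarrow> p \<noteq> 0 \<Longrightarrow>
         identified (A13, mat22 0 b c 0) (A13, mat22 0 (p^3 * b) (p^3 * c) 0)"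
| i18: "b\<^sup>2 \<noteq> 0 \<Longrightarrow> p \<noteq> 0 \<Longrightarrow>
         identified (A13, mat22 a b (-b) 0) (A13, mat22 (p^2 * a) (p^3 * b) (-(p^3 * b)) 0)"

end

theory Submission
  imports Defs
begin

text \<open>
  In a non-trivial two-dimensional associative algebra either some \<open>x\<close> and \<open>x\<^sup>2\<close> are linearly
  independent, so that the algebra is generated by \<open>x\<close> and the relation
  \<open>x\<^sup>3 = p x + q x\<^sup>2\<close> decides its type, or every \<open>x\<^sup>2\<close> is a multiple of \<open>x\<close>, so that there is
  an idempotent, whose Peirce decomposition gives the two noncommutative algebras. The
  types are told apart by nilpotency and by the existence of left and right units. Within one type,
  an isomorphism is a basis with prescribed multiplication table; these bases form an explicit group
  of substitutions, whose action on Gram matrices is then brought to normal form.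
\<close>

section \<open>Isomorphisms of pairs in coordinates\<close>

text \<open>In the algebras with 1/2 in their tables \<open>2 e1\<close> is idempotent: it is a
  right unit of \<open>A3_half_0_0\<close> and the unit of \<open>A3_half_half \<alpha>\<close>,
  which is F[y]/(y^2 - \<alpha>/2). Over an arbitrary field this family can only be reduced to
  \<alpha> modulo nonzero squares, hence the set \<open>R\<close> of representatives. The bases that
  reproduce the table are \<open>e1\<close>, \<open>t e2\<close> for \<open>A3_1_0_0\<close> and
  \<open>A3_half_half 0\<close>; \<open>e1 + q e2\<close>, \<open>t e2\<close> for the two
  noncommutative algebras; \<open>p e1 + q e2\<close>, \<open>p^2 e2\<close> for \<open>A13\<close>.
  Once an off-diagonal entry has been scaled to 1, \<open>t\<close> is used up; for diagonal
  matrices it survives as the identification by \<open>t^2\<close>. For \<alpha> nonzero only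
  \<open>t = 1\<close> and \<open>t = -1\<close> keep \<alpha>, which leaves a sign to identify. In
  \<open>A13\<close> the entries scale with \<open>p^2\<close>, \<open>p^3\<close>,
  \<open>p^4\<close>, so over an arbitrary field \<open>p\<close> stays as an
  identification.\<close>

lemma vector_4:
  "(vector [a, b, c, d] :: 'a::zero^4) $ 1 = a" "(vector [a, b, c, d] :: 'a::zero^4) $ 2 = b"
  "(vector [a, b, c, d] :: 'a::zero^4) $ 3 = c" "(vector [a, b, c, d] :: 'a::zero^4) $ 4 = d"
  unfolding vector_def by simp_all

lemma vec2_eq_iff: "x = y \<longleftrightarrow> x $ 1 = y $ 1 \<and> x $ 2 = y $ 2" for x y :: "'a^2"
  by (simp add: vec_eq_iff forall_2)

lemma mat22_component [simp]:
  "mat22 a b c d $ 1 $ 1 = a" "mat22 a b c d $ 1 $ 2 = b"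
  "mat22 a b c d $ 2 $ 1 = c" "mat22 a b c d $ 2 $ 2 = d"
  by (simp_all add: mat22_def)

lemma mat22_eq_iff [simp]:
  "mat22 a b c d = mat22 a' b' c' d' \<longleftrightarrow> a = a' \<and> b = b' \<and> c = c' \<and> d = d'"
  by (auto simp: vec2_eq_iff)

lemma mat22_collapse: "mat22 (S $ 1 $ 1) (S $ 1 $ 2) (S $ 2 $ 1) (S $ 2 $ 2) = S"
  by (simp add: vec2_eq_iff)

lemma sc_mult_component:
  "sc_mult A x y $ i = A $ i $ 1 * (x $ 1 * y $ 1) + A $ i $ 2 * (x $ 1 * y $ 2)
     + A $ i $ 3 * (x $ 2 * y $ 1) + A $ i $ 4 * (x $ 2 * y $ 2)"
  by (simp add: sc_mult_def matrix_vector_mult_def sum_4 vector_4)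

lemma gram_form_expand:
  "gram_form S x y = x $ 1 * S $ 1 $ 1 * y $ 1 + x $ 1 * S $ 1 $ 2 * y $ 2
     + x $ 2 * S $ 2 $ 1 * y $ 1 + x $ 2 * S $ 2 $ 2 * y $ 2"
  by (simp add: gram_form_def matrix_vector_mult_def sum_2 algebra_simps)

lemma vector_space_field: "vector_space ((*) :: 'a::field \<Rightarrow> 'a \<Rightarrow> 'a)"
  by unfold_locales (simp_all add: algebra_simps)

lemma bilinear_mapI:
  assumes "vector_space s" "vector_space s'"
    and "\<And>x y z. f (x + y) z = f x z + f y z" "\<And>x y z. f x (y + z) = f x y + f x z"
    and "\<And>c x y. f (s c x) y = s' c (f x y)" "\<And>c x y. f x (s c y) = s' c (f x y)"
  shows "bilinear_map s s' f"
  using assms by (simp add: bilinear_map_def Vector_Spaces.linear_iff)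

lemma bilinear_mapD:
  assumes "bilinear_map s s' f"
  shows "f (x + y) z = f x z + f y z" "f x (y + z) = f x y + f x z"
    and "f (s c x) y = s' c (f x y)" "f x (s c y) = s' c (f x y)"
  using assms by (simp_all add: bilinear_map_def Vector_Spaces.linear_iff)

lemma bilinear_sc_mult: "bilinear_map (*s) (*s) (sc_mult A)"
  by (rule bilinear_mapI)
    (simp_all add: vec.vector_space_axioms vec_eq_iff sc_mult_component algebra_simps)

lemma bilinear_gram_form: "bilinear_map (*s) (*) (gram_form S)"
  by (rule bilinear_mapI)
    (simp_all add: vec.vector_space_axioms vector_space_field gram_form_expand algebra_simps)

section \<open>Isomorphism of pairs is an equivalence relation\<close>

lemma algebra_isomorphism_inv:
  assumes "algebra_isomorphism s m s' m' f"
  shows "algebra_isomorphism s' m' s m (inv f)"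
proof -
  have lin: "Vector_Spaces.linear s s' f" and f: "bij f" and mult: "\<And>x y. f (m x y) = m' (f x) (f y)"
    using assms by (auto simp: algebra_isomorphism_def)
  have s: "surj f" and i: "inj f" using f by (auto simp: bij_def)
  have 1: "inv f (x + y) = inv f x + inv f y" for x y
    by (rule inv_f_eq[OF i]) (use lin surj_f_inv_f[OF s] in \<open>simp add: Vector_Spaces.linear_iff\<close>)
  have 2: "inv f (s' c x) = s c (inv f x)" for c x
    by (rule inv_f_eq[OF i]) (use lin surj_f_inv_f[OF s] in \<open>simp add: Vector_Spaces.linear_iff\<close>)
  have 3: "inv f (m' x y) = m (inv f x) (inv f y)" for x y
    by (rule inv_f_eq[OF i]) (use mult surj_f_inv_f[OF s] in simp)
  show ?thesis
    using lin 1 2 3 bij_imp_bij_inv[OF f] by (simp add: algebra_isomorphism_def Vector_Spaces.linear_iff)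
qed

lemma pairs_isomorphic_refl: "vector_space s \<Longrightarrow> pairs_isomorphic s m \<sigma> s m \<sigma>"
  unfolding pairs_isomorphic_def algebra_isomorphism_def
  by (intro exI[of _ id]) (simp add: vector_space.linear_id)

lemma pairs_isomorphic_sym:
  assumes "pairs_isomorphic s m \<sigma> s' m' \<tau>"
  shows "pairs_isomorphic s' m' \<tau> s m \<sigma>"
proof -
  obtain f where f: "algebra_isomorphism s m s' m' f" "\<And>x y. \<sigma> x y = \<tau> (f x) (f y)"
    using assms by (auto simp: pairs_isomorphic_def)
  have "surj f" using f(1) by (simp add: algebra_isomorphism_def bij_def)
  then have "\<tau> x y = \<sigma> (inv f x) (inv f y)" for x y
    by (simp add: f(2) surj_f_inv_f)
  then show ?thesis
    using algebra_isomorphism_inv[OF f(1)] by (auto simp: pairs_isomorphic_def)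
qed

lemma pairs_isomorphic_trans:
  assumes "pairs_isomorphic s m \<sigma> s' m' \<tau>" "pairs_isomorphic s' m' \<tau> s'' m'' \<rho>"
  shows "pairs_isomorphic s m \<sigma> s'' m'' \<rho>"
proof -
  obtain f g where "algebra_isomorphism s m s' m' f" "\<And>x y. \<sigma> x y = \<tau> (f x) (f y)"
    and "algebra_isomorphism s' m' s'' m'' g" "\<And>x y. \<tau> x y = \<rho> (g x) (g y)"
    using assms by (auto simp: pairs_isomorphic_def)
  then show ?thesis
    unfolding pairs_isomorphic_def algebra_isomorphism_def
    by (intro exI[of _ "g \<circ> f"]) (auto simp: bij_comp Vector_Spaces.linear_iff)
qed

section \<open>Isomorphisms as bases of the target\<close>

definition frame :: "('a::field \<Rightarrow> 'v::ab_group_add \<Rightarrow> 'v) \<Rightarrow> 'v \<Rightarrow> 'v \<Rightarrow> 'a^2 \<Rightarrow> 'v" where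
  "frame s u v x = s (x $ 1) u + s (x $ 2) v"

text \<open>Independence of \<open>u\<close> and \<open>v\<close> is kept apart: it is a determinant
  condition in coordinates and \<open>indep\<close> in an abstract algebra, while these equations
  serve both.\<close>

definition has_table ::
  "('a::field \<Rightarrow> 'v::ab_group_add \<Rightarrow> 'v) \<Rightarrow> ('v \<Rightarrow> 'v \<Rightarrow> 'v) \<Rightarrow> 'a^4^2 \<Rightarrow> 'v \<Rightarrow> 'v \<Rightarrow> bool" where
  "has_table s m A u v \<longleftrightarrow>
     m u u = s (A $ 1 $ 1) u + s (A $ 2 $ 1) v \<and> m u v = s (A $ 1 $ 2) u + s (A $ 2 $ 2) v \<and>
     m v u = s (A $ 1 $ 3) u + s (A $ 2 $ 3) v \<and> m v v = s (A $ 1 $ 4) u + s (A $ 2 $ 4) v"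

text \<open>By bilinearity, products and values of the form need comparing on the basis only. The
  isomorphism runs from coordinates to the abstract pair, so no coordinate functions have to be
  chosen.\<close>

lemma frame_pairs_isomorphic:
  assumes V: "vector_space s" and m: "bilinear_map s s m" and \<sigma>: "bilinear_map s (*) \<sigma>"
    and fr: "bij (frame s u v)" and table: "has_table s m A u v"
    and gram: "S = mat22 (\<sigma> u u) (\<sigma> u v) (\<sigma> v u) (\<sigma> v v)"
  shows "pairs_isomorphic (*s) (sc_mult A) (gram_form S) s m \<sigma>"
proof -
  interpret vector_space s by (fact V)
  have "Vector_Spaces.linear (*s) s (frame s u v)"
    by (simp add: Vector_Spaces.linear_iff V vec.vector_space_axioms frame_def algebra_simps)
  moreover have "frame s u v (sc_mult A x y) = m (frame s u v x) (frame s u v y)" for x y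
    using table
    by (simp add: frame_def has_table_def sc_mult_component bilinear_mapD[OF m] scale_left_distrib
        scale_right_distrib add_ac mult_ac)
  moreover have "gram_form S x y = \<sigma> (frame s u v x) (frame s u v y)" for x y
    by (simp add: frame_def gram gram_form_expand bilinear_mapD[OF \<sigma>] algebra_simps)
  ultimately show ?thesis
    using fr by (auto simp: pairs_isomorphic_def algebra_isomorphism_def)
qed

lemma bij_frame_cart:
  fixes u v :: "'a::field^2"
  shows "bij (frame (*s) u v) \<longleftrightarrow> u $ 1 * v $ 2 - u $ 2 * v $ 1 \<noteq> 0"
proof
  assume b: "bij (frame (*s) u v)"
  show "u $ 1 * v $ 2 - u $ 2 * v $ 1 \<noteq> 0"
  proof
    assume d: "u $ 1 * v $ 2 - u $ 2 * v $ 1 = 0"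
    \<comment> \<open>A vanishing determinant puts these two vectors in the kernel; injectivity
      makes them zero, so \<open>u = v = 0\<close> and the map itself is zero.\<close>
    then have "frame (*s) u v (vector [v $ 1, - u $ 1]) = frame (*s) u v 0"
      and "frame (*s) u v (vector [v $ 2, - u $ 2]) = frame (*s) u v 0"
      by (simp_all add: frame_def vec2_eq_iff algebra_simps)
    then have "vector [v $ 1, - u $ 1] = (0 :: 'a^2)" "vector [v $ 2, - u $ 2] = (0 :: 'a^2)"
      using b by (auto simp: bij_def dest: injD)
    then have "u = 0" "v = 0" by (simp_all add: vec2_eq_iff)
    then have "frame (*s) u v 1 = frame (*s) u v 0" by (simp add: frame_def)
    then show False using b by (auto simp: bij_def dest: injD)
  qed
next
  define D where "D = u $ 1 * v $ 2 - u $ 2 * v $ 1"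
  assume "u $ 1 * v $ 2 - u $ 2 * v $ 1 \<noteq> 0"
  then have D: "D \<noteq> 0" by (simp add: D_def)
  \<comment> \<open>The inverse is given by Cramer's rule.\<close>
  define g :: "'a^2 \<Rightarrow> 'a^2" where
    "g w = vector [(w $ 1 * v $ 2 - w $ 2 * v $ 1) / D, (u $ 1 * w $ 2 - u $ 2 * w $ 1) / D]" for w
  have "g (frame (*s) u v x) = x" for x
  proof -
    have "g (frame (*s) u v x) = vector [x $ 1 * D / D, x $ 2 * D / D]"
      by (simp add: g_def frame_def D_def algebra_simps)
    with D show ?thesis by (simp add: vec2_eq_iff)
  qed
  moreover have "frame (*s) u v (g w) = w" for w
  proof -
    have "u $ i * (w $ 1 * v $ 2 - w $ 2 * v $ 1) + v $ i * (u $ 1 * w $ 2 - u $ 2 * w $ 1) = w $ i * D"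
      if "i = 1 \<or> i = 2" for i
      using that by (auto simp: D_def algebra_simps)
    with D show ?thesis
      by (simp add: g_def frame_def vec2_eq_iff add_divide_distrib[symmetric] mult_ac)
  qed
  ultimately show "bij (frame (*s) u v)" by (intro o_bij[of g]) auto
qed

text \<open>A linear map is determined by the images \<open>u\<close>, \<open>v\<close> of the
  standard basis, so isomorphism becomes a system of polynomial equations in four unknowns. Here
  \<open>u\<close>, \<open>v\<close> lie in the target and follow the table of the source.\<close>

lemma pairs_isomorphic_cart_iff:
  fixes A B :: "'a::field^4^2"
  shows "pairs_isomorphic (*s) (sc_mult A) (gram_form S) (*s) (sc_mult B) (gram_form T) \<longleftrightarrow>
    (\<exists>u v. u $ 1 * v $ 2 - u $ 2 * v $ 1 \<noteq> 0 \<and> has_table (*s) (sc_mult B) A u v \<and>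
       S = mat22 (gram_form T u u) (gram_form T u v) (gram_form T v u) (gram_form T v v))"
    (is "_ \<longleftrightarrow> ?rhs")
proof
  assume "pairs_isomorphic (*s) (sc_mult A) (gram_form S) (*s) (sc_mult B) (gram_form T)"
  then obtain f where f: "Vector_Spaces.linear (*s) (*s) f" "bij f"
    and mult: "\<And>x y. f (sc_mult A x y) = sc_mult B (f x) (f y)"
    and form: "\<And>x y. gram_form S x y = gram_form T (f x) (f y)"
    by (auto simp: pairs_isomorphic_def algebra_isomorphism_def)
  let ?e = "vector [1, 0] :: 'a^2" and ?e' = "vector [0, 1] :: 'a^2"
  have expand: "frame (*s) ?e ?e' x = x" for x
    by (simp add: frame_def vec2_eq_iff)
  have f_frame: "f x = frame (*s) (f ?e) (f ?e') x" for x
    using f(1) by (subst expand[symmetric]) (simp add: frame_def Vector_Spaces.linear_iff)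
  then have "f = frame (*s) (f ?e) (f ?e')" by blast
  with f(2) have "bij (frame (*s) (f ?e) (f ?e'))" by simp
  moreover have "has_table (*s) (sc_mult B) A (f ?e) (f ?e')"
    unfolding has_table_def mult[symmetric]
    by (simp add: f_frame[of "sc_mult A x y" for x y] frame_def[of _ "f ?e" "f ?e'"] sc_mult_component)
  moreover have "S = mat22 (gram_form T (f ?e) (f ?e)) (gram_form T (f ?e) (f ?e'))
      (gram_form T (f ?e') (f ?e)) (gram_form T (f ?e') (f ?e'))"
    unfolding form[symmetric] by (simp add: gram_form_expand mat22_collapse)
  ultimately show ?rhs unfolding bij_frame_cart by blast
next
  assume ?rhs
  then show "pairs_isomorphic (*s) (sc_mult A) (gram_form S) (*s) (sc_mult B) (gram_form T)"
    unfolding bij_frame_cart[symmetric]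
    by (elim exE conjE)
      (rule frame_pairs_isomorphic[OF vec.vector_space_axioms bilinear_sc_mult bilinear_gram_form])
qed

section \<open>Isomorphisms within each type of algebra\<close>

abbreviation (input) iso_cart where
  "iso_cart A S B T \<equiv> pairs_isomorphic (*s) (sc_mult A) (gram_form S) (*s) (sc_mult B) (gram_form T)"

lemmas table_simps = has_table_def vec2_eq_iff sc_mult_component vector_4
  A3_1_0_0_def A3_1_0_1_def A3_half_0_0_def A3_half_half_def A13_def

lemma iso_cartI:
  assumes "p * t - q * r \<noteq> 0" "has_table (*s) (sc_mult B) A (vector [p, q]) (vector [r, t])"
    and "S = mat22 (gram_form T (vector [p, q]) (vector [p, q])) (gram_form T (vector [p, q]) (vector [r, t]))
          (gram_form T (vector [r, t]) (vector [p, q])) (gram_form T (vector [r, t]) (vector [r, t]))"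
  shows "iso_cart A S B T"
  unfolding pairs_isomorphic_cart_iff using assms
  by (intro exI[of _ "vector [p, q]"] exI[of _ "vector [r, t]"]) simp

lemma iso_cartE:
  assumes "iso_cart A S B T"
  obtains p q r t where "p * t - q * r \<noteq> 0" "has_table (*s) (sc_mult B) A (vector [p, q]) (vector [r, t])"
    and "S = mat22 (gram_form T (vector [p, q]) (vector [p, q])) (gram_form T (vector [p, q]) (vector [r, t]))
          (gram_form T (vector [r, t]) (vector [p, q])) (gram_form T (vector [r, t]) (vector [r, t]))"
proof -
  obtain u v :: "'a^2" where uv: "u $ 1 * v $ 2 - u $ 2 * v $ 1 \<noteq> 0" "has_table (*s) (sc_mult B) A u v"
      "S = mat22 (gram_form T u u) (gram_form T u v) (gram_form T v u) (gram_form T v v)"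
    using assms unfolding pairs_isomorphic_cart_iff by blast
  have "u = vector [u $ 1, u $ 2]" "v = vector [v $ 1, v $ 2]" by (simp_all add: vec2_eq_iff)
  then show ?thesis using that uv by metis
qed

text \<open>\<open>e1\<close> is the only nonzero idempotent and \<open>e2\<close> spans the
  annihilator, so \<open>u = e1\<close> and \<open>v\<close> is a nonzero multiple of
  \<open>e2\<close>.\<close>

lemma iso_A3_1_0_0:
  "iso_cart A3_1_0_0 (mat22 a b c d) A3_1_0_0 (mat22 a' b' c' d') \<longleftrightarrow>
    (\<exists>t. t \<noteq> 0 \<and> a = a' \<and> b = t * b' \<and> c = t * c' \<and> d = t\<^sup>2 * d')" (is "?l \<longleftrightarrow> ?r")
proof
  assume ?l
  then show ?r
    by (rule iso_cartE) (auto simp: table_simps gram_form_expand power2_eq_square)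
next
  assume ?r
  then obtain t where "t \<noteq> 0" "a = a'" "b = t * b'" "c = t * c'" "d = t\<^sup>2 * d'" by blast
  then show ?l
    by (intro iso_cartI[of 1 t 0 0]) (auto simp: table_simps gram_form_expand power2_eq_square)
qed

text \<open>The product is \<open>x y = x$1 y\<close>. The table therefore asks only for first
  coordinate 1 in \<open>u\<close> and 0 in \<open>v\<close>; the second coordinate \<open>q\<close>
  of \<open>u\<close> is free and shears the form.\<close>

lemma iso_A3_1_0_1:
  "iso_cart A3_1_0_1 (mat22 a b c d) A3_1_0_1 (mat22 a' b' c' d') \<longleftrightarrow>
    (\<exists>q t. t \<noteq> 0 \<and> a = a' + q * (b' + c') + q\<^sup>2 * d' \<and> b = t * (b' + q * d') \<and>
       c = t * (c' + q * d') \<and> d = t\<^sup>2 * d')" (is "?l \<longleftrightarrow> ?r")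
proof
  assume ?l
  then show ?r
  proof (rule iso_cartE)
    fix p q r t
    assume *: "p * t - q * r \<noteq> 0" "has_table (*s) (sc_mult A3_1_0_1) A3_1_0_1 (vector [p, q]) (vector [r, t])"
      and S: "mat22 a b c d = mat22 (gram_form (mat22 a' b' c' d') (vector [p, q]) (vector [p, q]))
          (gram_form (mat22 a' b' c' d') (vector [p, q]) (vector [r, t]))
          (gram_form (mat22 a' b' c' d') (vector [r, t]) (vector [p, q]))
          (gram_form (mat22 a' b' c' d') (vector [r, t]) (vector [r, t]))"
    have "p = 1" "r = 0" "t \<noteq> 0" using * by (auto simp: table_simps)
    with S show ?r
      by (intro exI[of _ q] exI[of _ t]) (auto simp: gram_form_expand power2_eq_square algebra_simps)
  qed
next
  assume ?r
  then obtain q t where "t \<noteq> 0" "a = a' + q * (b' + c') + q\<^sup>2 * d'" "b = t * (b' + q * d')"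
    "c = t * (c' + q * d')" "d = t\<^sup>2 * d'" by blast
  then show ?l
    by (intro iso_cartI[of 1 t q 0])
      (auto simp: table_simps gram_form_expand power2_eq_square algebra_simps)
qed

text \<open>Mirror image of \<open>A3_1_0_1\<close>: here \<open>x y = (1/2) y$1 x\<close>, which
  admits the same bases.\<close>

lemma iso_A3_half_0_0:
  fixes a :: "'a::field"
  assumes two: "(2 :: 'a) \<noteq> 0"
  shows "iso_cart A3_half_0_0 (mat22 a b c d) A3_half_0_0 (mat22 a' b' c' d') \<longleftrightarrow>
    (\<exists>q t. t \<noteq> 0 \<and> a = a' + q * (b' + c') + q\<^sup>2 * d' \<and> b = t * (b' + q * d') \<and>
       c = t * (c' + q * d') \<and> d = t\<^sup>2 * d')" (is "?l \<longleftrightarrow> ?r")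
proof
  assume ?l
  then show ?r
  proof (rule iso_cartE)
    fix p q r t
    assume *: "p * t - q * r \<noteq> 0" "has_table (*s) (sc_mult A3_half_0_0) A3_half_0_0 (vector [p, q]) (vector [r, t])"
      and S: "mat22 a b c d = mat22 (gram_form (mat22 a' b' c' d') (vector [p, q]) (vector [p, q]))
          (gram_form (mat22 a' b' c' d') (vector [p, q]) (vector [r, t]))
          (gram_form (mat22 a' b' c' d') (vector [r, t]) (vector [p, q]))
          (gram_form (mat22 a' b' c' d') (vector [r, t]) (vector [r, t]))"
    have "p = 1" "r = 0" "t \<noteq> 0" using * two by (auto simp: table_simps)
    with S show ?r
      by (intro exI[of _ q] exI[of _ t]) (auto simp: gram_form_expand power2_eq_square algebra_simps)
  qed
next
  assume ?r
  then obtain q t where "t \<noteq> 0" "a = a' + q * (b' + c') + q\<^sup>2 * d'" "b = t * (b' + q * d')"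
    "c = t * (c' + q * d')" "d = t\<^sup>2 * d'" by blast
  then show ?l
    by (intro iso_cartI[of 1 t q 0])
      (auto simp: table_simps gram_form_expand power2_eq_square algebra_simps)
qed

text \<open>The table forces \<open>v = u u\<close>, and squaring \<open>p e1 + q e2\<close> gives
  \<open>p^2 e2\<close>.\<close>

lemma iso_A13:
  "iso_cart A13 (mat22 a b c d) A13 (mat22 a' b' c' d') \<longleftrightarrow>
    (\<exists>p q. p \<noteq> 0 \<and> a = p\<^sup>2 * a' + p * q * (b' + c') + q\<^sup>2 * d' \<and> b = p\<^sup>2 * (p * b' + q * d') \<and>
       c = p\<^sup>2 * (p * c' + q * d') \<and> d = p ^ 4 * d')" (is "?l \<longleftrightarrow> ?r")
proof
  assume ?l
  then show ?r
  proof (rule iso_cartE)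
    fix p q r t
    assume *: "p * t - q * r \<noteq> 0" "has_table (*s) (sc_mult A13) A13 (vector [p, q]) (vector [r, t])"
      and S: "mat22 a b c d = mat22 (gram_form (mat22 a' b' c' d') (vector [p, q]) (vector [p, q]))
          (gram_form (mat22 a' b' c' d') (vector [p, q]) (vector [r, t]))
          (gram_form (mat22 a' b' c' d') (vector [r, t]) (vector [p, q]))
          (gram_form (mat22 a' b' c' d') (vector [r, t]) (vector [r, t]))"
    have "p \<noteq> 0" "r = 0" "t = p * p" using * by (auto simp: table_simps)
    with S show ?r
      by (intro exI[of _ p] exI[of _ q])
        (auto simp: gram_form_expand power2_eq_square power4_eq_xxxx algebra_simps)
  qed
next
  assume ?r
  then obtain p q where "p \<noteq> 0" "a = p\<^sup>2 * a' + p * q * (b' + c') + q\<^sup>2 * d'"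
    "b = p\<^sup>2 * (p * b' + q * d')" "c = p\<^sup>2 * (p * c' + q * d')" "d = p ^ 4 * d'" by blast
  then show ?l
    by (intro iso_cartI[of p "p\<^sup>2" q 0])
      (auto simp: table_simps gram_form_expand power2_eq_square power4_eq_xxxx algebra_simps)
qed

text \<open>The unit \<open>2 e1\<close> is preserved, so \<open>u = e1\<close>; then
  \<open>v v = \<alpha> u\<close> has no \<open>e2\<close> component, which forces
  \<open>v = t e2\<close>.\<close>

lemma iso_A3_half_half:
  fixes \<alpha> :: "'a::field"
  assumes two: "(2 :: 'a) \<noteq> 0"
  shows "iso_cart (A3_half_half \<alpha>) (mat22 a b c d) (A3_half_half \<beta>) (mat22 a' b' c' d') \<longleftrightarrow>
    (\<exists>t. t \<noteq> 0 \<and> \<alpha> = t\<^sup>2 * \<beta> \<and> a = a' \<and> b = t * b' \<and> c = t * c' \<and> d = t\<^sup>2 * d')" (is "?l \<longleftrightarrow> ?r")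
proof
  assume ?l
  then show ?r
  proof (rule iso_cartE)
    fix p q r t
    assume det: "p * t - q * r \<noteq> 0"
      and table: "has_table (*s) (sc_mult (A3_half_half \<beta>)) (A3_half_half \<alpha>) (vector [p, q]) (vector [r, t])"
      and S: "mat22 a b c d = mat22 (gram_form (mat22 a' b' c' d') (vector [p, q]) (vector [p, q]))
          (gram_form (mat22 a' b' c' d') (vector [p, q]) (vector [r, t]))
          (gram_form (mat22 a' b' c' d') (vector [r, t]) (vector [p, q]))
          (gram_form (mat22 a' b' c' d') (vector [r, t]) (vector [r, t]))"
    have eqs: "2 * p\<^sup>2 + 4 * \<beta> * q\<^sup>2 = 2 * p" "2 * (p * q) = q" "2 * p * r + 4 * \<beta> * q * t = 2 * r"
        "r\<^sup>2 + 2 * \<beta> * t\<^sup>2 = 2 * \<alpha> * p" "r * t = \<alpha> * q"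
      using table two by (simp_all add: table_simps field_simps power2_eq_square)
    \<comment> \<open>Otherwise \<open>p = 1/2\<close> and \<open>2 u\<close> would be an idempotent
      other than the unit; the remaining equations then make \<open>v\<close> a multiple of
      \<open>u\<close>.\<close>
    have "q = 0"
    proof (rule ccontr)
      assume q: "q \<noteq> 0"
      with eqs(2) have p: "2 * p = 1" by (auto simp: mult_ac)
      then have "8 * \<beta> * q\<^sup>2 = 1" "4 * \<beta> * q * t = r"
        using eqs(1,3) by algebra+
      then have "t = 2 * (q * r)" by algebra
      then have "2 * (p * t - q * r) = 0" using p by algebra
      then show False using two det by simp
    qed
    moreover from this have "p = 1" using eqs(1) det two by (simp add: power2_eq_square)
    moreover have "t \<noteq> 0" using calculation det by simp
    moreover have "r = 0" using calculation eqs(5) by simp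
    moreover have "\<alpha> = t\<^sup>2 * \<beta>" using calculation eqs(4) two by (simp add: mult_ac)
    ultimately show ?r using S
      by (intro exI[of _ t]) (simp add: gram_form_expand power2_eq_square)
  qed
next
  assume ?r
  then obtain t where "t \<noteq> 0" "\<alpha> = t\<^sup>2 * \<beta>" "a = a'" "b = t * b'" "c = t * c'" "d = t\<^sup>2 * d'" by blast
  then show ?l
    by (intro iso_cartI[of 1 t 0 0]) (auto simp: table_simps gram_form_expand power2_eq_square)
qed

text \<open>An algebra isomorphism is an isomorphism of pairs for the zero form.\<close>

lemma algebra_isomorphic_A3_half_half:
  fixes \<alpha> :: "'a::field"
  assumes "(2 :: 'a) \<noteq> 0"
  shows "(\<exists>f. algebra_isomorphism (*s) (sc_mult (A3_half_half \<alpha>)) (*s) (sc_mult (A3_half_half \<beta>)) f) \<longleftrightarrow>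
    (\<exists>t. t \<noteq> 0 \<and> \<alpha> = t\<^sup>2 * \<beta>)"
proof -
  have "gram_form (mat22 0 0 0 0) x y = 0" for x y :: "'a^2"
    by (simp add: gram_form_expand)
  then show ?thesis
    using iso_A3_half_half[OF assms, of \<alpha> 0 0 0 0 \<beta> 0 0 0 0] by (simp add: pairs_isomorphic_def)
qed

section \<open>Separating the types of algebras\<close>

text \<open>The two unit flags separate all types except \<open>A3_1_0_0\<close> and
  \<open>A13\<close>, which have no one-sided unit; a nonzero triple product tells these two
  apart.\<close>

definition mult_invariants :: "('v::zero \<Rightarrow> 'v \<Rightarrow> 'v) \<Rightarrow> bool \<times> bool \<times> bool" where
  "mult_invariants m =
     (\<exists>e. \<forall>x. m e x = x, \<exists>e. \<forall>x. m x e = x, \<exists>x y z. m (m x y) z \<noteq> 0)"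

lemma mult_invariants_eq:
  assumes "pairs_isomorphic s m \<sigma> s' m' \<tau>"
  shows "mult_invariants m = mult_invariants m'"
proof -
  \<comment> \<open>Implications for arbitrary isomorphic pairs suffice: the converses come from the
    inverse isomorphism.\<close>
  have transport: "((\<exists>e. \<forall>x. m e x = x) \<longrightarrow> (\<exists>e. \<forall>x. m' e x = x)) \<and>
      ((\<exists>e. \<forall>x. m x e = x) \<longrightarrow> (\<exists>e. \<forall>x. m' x e = x)) \<and>
      ((\<exists>x y z. m (m x y) z \<noteq> 0) \<longrightarrow> (\<exists>x y z. m' (m' x y) z \<noteq> 0))"
    if iso: "pairs_isomorphic s m \<sigma> s' m' \<tau>" for s s' \<sigma> \<tau> and m :: "'v::ab_group_add \<Rightarrow> _" and m' :: "'w::ab_group_add \<Rightarrow> _"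
  proof -
    obtain f where f: "bij f" "\<And>x y. f (m x y) = m' (f x) (f y)" and "Vector_Spaces.linear s s' f"
      using iso by (auto simp: pairs_isomorphic_def algebra_isomorphism_def)
    then have "f (0 + 0) = f 0 + f 0" unfolding Vector_Spaces.linear_iff by blast
    then have "f 0 = 0" by simp
    then have nz: "f x \<noteq> 0" if "x \<noteq> 0" for x using f(1) that by (metis bij_def injD)
    have surj: "\<exists>x. y = f x" for y using f(1) by (metis bij_pointE)
    have "m' (f e) y = y" if "\<forall>x. m e x = x" for e y
      using surj[of y] that by (auto simp: f(2)[symmetric])
    moreover have "m' y (f e) = y" if "\<forall>x. m x e = x" for e y
      using surj[of y] that by (auto simp: f(2)[symmetric])
    moreover have "m' (m' (f x) (f y)) (f z) \<noteq> 0" if "m (m x y) z \<noteq> 0" for x y z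
      using nz[OF that] by (simp add: f(2))
    ultimately show ?thesis by blast
  qed
  show ?thesis
    using transport[OF assms] transport[OF pairs_isomorphic_sym[OF assms]]
    unfolding mult_invariants_def by blast
qed

lemma ex_vec2: "(\<exists>v :: 'a::zero^2. P v) \<longleftrightarrow> (\<exists>x y. P (vector [x, y]))"
  using forall_vector_2[of "\<lambda>v. \<not> P v"] by blast

lemma mult_invariants_types:
  assumes "(2 :: 'a::field) \<noteq> 0"
  shows "mult_invariants (sc_mult (A3_1_0_0 :: 'a^4^2)) = (False, False, True)"
    and "mult_invariants (sc_mult (A3_1_0_1 :: 'a^4^2)) = (True, False, True)"
    and "mult_invariants (sc_mult (A3_half_0_0 :: 'a^4^2)) = (False, True, True)"
    and "mult_invariants (sc_mult (A3_half_half \<alpha> :: 'a^4^2)) = (True, True, True)"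
    and "mult_invariants (sc_mult (A13 :: 'a^4^2)) = (False, False, False)"
proof -
  \<comment> \<open>Triple products in \<open>A3_half_0_0\<close> carry the coefficient 1/4.\<close>
  have "(4 :: 'a) = 2 * 2" by simp
  then have four: "(4 :: 'a) \<noteq> 0" using assms by (metis mult_eq_0_iff)
  note simps = mult_invariants_def forall_vector_2 ex_vec2 vec2_eq_iff sc_mult_component vector_4
    A3_1_0_0_def A3_1_0_1_def A3_half_0_0_def A3_half_half_def A13_def
  show "mult_invariants (sc_mult (A3_1_0_0 :: 'a^4^2)) = (False, False, True)"
    by (auto simp: simps intro: exI[of _ 1])
  show "mult_invariants (sc_mult (A3_1_0_1 :: 'a^4^2)) = (True, False, True)"
    by (auto simp: simps intro: exI[of _ 1] exI[of _ 0]) (metis mult_zero_left zero_neq_one)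
  show "mult_invariants (sc_mult (A3_half_0_0 :: 'a^4^2)) = (False, True, True)"
    using assms four by (auto simp: simps intro: exI[of _ 2]) (metis mult_1 mult_zero_right)
  let ?M = "sc_mult (A3_half_half \<alpha> :: 'a^4^2)" and ?e = "vector [2, 0] :: 'a^2"
  have e: "?M ?e x = x" "?M x ?e = x" "?e \<noteq> 0" for x
    using assms by (simp_all add: simps)
  then have "?M (?M ?e ?e) ?e \<noteq> 0" by simp
  with e(1,2) show "mult_invariants ?M = (True, True, True)"
    unfolding mult_invariants_def by blast
  show "mult_invariants (sc_mult (A13 :: 'a^4^2)) = (False, False, False)"
    by (auto simp: simps intro: exI[of _ 1])
qed

section \<open>Two-dimensional associative algebras\<close>

definition assoc_types :: "('a::field^4^2) set" where
  "assoc_types = {A3_1_0_0, A3_1_0_1, A3_half_0_0, A13} \<union> range A3_half_half"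

locale two_dim_algebra = vector_space s
  for s :: "'a::field \<Rightarrow> 'v::ab_group_add \<Rightarrow> 'v" +
  fixes m :: "'v \<Rightarrow> 'v \<Rightarrow> 'v"
  assumes two_dim_assoc: "two_dim_assoc_algebra s m"
begin

lemma bilinear_mult: "bilinear_map s s m"
  and assoc: "m (m x y) z = m x (m y z)"
  and dim_UNIV_2: "dim UNIV = 2"
  using two_dim_assoc by (auto simp: two_dim_assoc_algebra_def)

lemmas mult_simps [simp] = bilinear_mapD[OF bilinear_mult]

lemma mult_zero [simp]: "m 0 x = 0" "m x 0 = 0"
  using mult_simps(3)[of 0 x x] mult_simps(4)[of x 0 x] by simp_all

lemma mult_minus [simp]: "m (- x) y = - m x y" "m x (- y) = - m x y"
  using mult_simps(3)[of "-1" x y] mult_simps(4)[of x "-1" y] by simp_all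

lemma mult_diff [simp]: "m (x - y) z = m x z - m y z" "m x (y - z) = m x y - m x z"
  using mult_simps(1)[of x "- y" z] mult_simps(2)[of x y "- z"] by simp_all

section \<open>Independent pairs and coordinates\<close>

text \<open>A condition on ordered pairs, because the set \<open>{x, y}\<close> would collapse for
  \<open>x = y\<close>.\<close>

definition indep :: "'v \<Rightarrow> 'v \<Rightarrow> bool" where
  "indep x y \<longleftrightarrow> (\<forall>a b. s a x + s b y = 0 \<longrightarrow> a = 0 \<and> b = 0)"

lemma indepD: "indep x y \<Longrightarrow> s a x + s b y = 0 \<Longrightarrow> a = 0 \<and> b = 0"
  by (simp add: indep_def)

lemma indepI: "x \<noteq> 0 \<Longrightarrow> (\<And>c. y \<noteq> s c x) \<Longrightarrow> indep x y"
proof -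
  assume x: "x \<noteq> 0" and y: "\<And>c. y \<noteq> s c x"
  have "a = 0 \<and> b = 0" if "s a x + s b y = 0" for a b
  proof -
    have "b = 0"
    proof (rule ccontr)
      assume b: "b \<noteq> 0"
      have "s b y = s (- a) x" using that by (simp add: eq_neg_iff_add_eq_0 add.commute)
      then have "s (1 / b) (s b y) = s (1 / b) (s (- a) x)" by simp
      then have "y = s (- a / b) x" using b by simp
      with y show False by blast
    qed
    then show ?thesis using that x by simp
  qed
  then show ?thesis by (auto simp: indep_def)
qed

text \<open>\<open>card\<close> of an infinite set is 0, so dimension 2 already forces
  finiteness.\<close>

lemma finite_basis: obtains B where "finite B" "card B = 2" "independent B" "span B = UNIV"
  using basis_exists[of UNIV] dim_UNIV_2 by (metis card.infinite top.extremum_uniqueI zero_neq_numeral)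

lemma ex_indep:
  assumes "x \<noteq> 0" obtains y where "indep x y"
proof -
  have "\<not> UNIV \<subseteq> span {x}"
    using span_card_ge_dim[of "{x}" UNIV] dim_UNIV_2 by auto
  then obtain y where "y \<notin> span {x}" by blast
  then have "y \<noteq> s c x" for c by (auto simp: span_singleton)
  with assms that indepI show ?thesis by blast
qed

text \<open>Independence gives injectivity; surjectivity is a dimension count, for which the finite
  basis makes the space a \<open>finite_dimensional_vector_space\<close>.\<close>

lemma bij_frame:
  assumes "indep x y" shows "bij (frame s x y)"
proof -
  obtain B where B: "finite B" "card B = 2" "independent B" "span B = UNIV" by (rule finite_basis)
  interpret fin: finite_dimensional_vector_space s B
    using B by unfold_locales auto
  have ind: "x \<notin> span {y}"
  proof
    assume "x \<in> span {y}"
    then obtain k where "s 1 x + s (- k) y = 0" by (auto simp: span_singleton)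
    with assms show False unfolding indep_def by (metis zero_neq_one)
  qed
  have "y \<noteq> 0" using assms unfolding indep_def by (metis add_0 scale_zero_left scale_one zero_neq_one)
  then have "independent {x, y}" "x \<noteq> y" using ind by (auto simp: independent_insert span_base)
  then have "UNIV \<subseteq> span {x, y}"
    by (intro fin.card_ge_dim_independent) (auto simp: dim_UNIV_2 simp del: fin.dim_UNIV)
  moreover have "\<exists>a b. w = s a x + s b y" if w: "w \<in> span {x, y}" for w
  proof -
    obtain a b where "w - s a x = s b y"
      using w by (auto simp: span_insert[of x] span_singleton)
    then show ?thesis by (metis diff_eq_eq add.commute)
  qed
  ultimately have "\<exists>a b. w = s a x + s b y" for w by blast
  then have "\<exists>c. w = frame s x y c" for w
    unfolding frame_def by (metis vector_2)
  then have "surj (frame s x y)" by blast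
  moreover have "inj (frame s x y)"
  proof (rule injI)
    fix c d assume "frame s x y c = frame s x y d"
    then have "s (c $ 1 - d $ 1) x + s (c $ 2 - d $ 2) y = 0"
      by (simp add: frame_def algebra_simps)
    from indepD[OF assms this] show "c = d" by (simp add: vec2_eq_iff)
  qed
  ultimately show ?thesis by (simp add: bij_def)
qed

lemma ex_coords:
  assumes "indep x y" obtains a b where "w = s a x + s b y"
  using bij_pointE[OF bij_frame[OF assms], of w] by (metis frame_def)

section \<open>Bases with a standard multiplication table\<close>

text \<open>With \<open>w = x^2\<close> and \<open>x^3 = p x + q w\<close>, everything is read off
  the polynomial \<open>t^3 - q t^2 - p t\<close>: \<open>t^3\<close> is the nilpotent case,
  \<open>t^2 (t - q)\<close> splits off an idempotent, and for \<open>p\<close> nonzero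
  \<open>t\<close> is invertible modulo \<open>t^2 - q t - p\<close>, which yields a unit.\<close>

lemma cyclic_table:
  assumes two: "(2 :: 'a) \<noteq> 0" and ind: "indep x (m x x)"
  shows "\<exists>A\<in>assoc_types. \<exists>u v. indep u v \<and> has_table s m A u v"
proof -
  define w where "w = m x x"
  obtain p q where xw: "m x w = s p x + s q w"
    using ex_coords[OF ind] unfolding w_def by metis
  have wx: "m w x = m x w" by (simp add: w_def assoc)
  \<comment> \<open>\<open>w w = x (x w)\<close> by associativity.\<close>
  have ww: "m w w = s p w + s q (m x w)"
    using mult_simps(2)[of x "s p x" "s q w"] by (simp add: w_def assoc) (simp add: xw[unfolded w_def])
  have coeff: "a = 0 \<and> b = 0" if "s a x + s b w = 0" for a b
    using ind that by (auto simp: indep_def w_def)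
  note prods = w_def[symmetric] wx ww xw
  consider "p = 0" "q = 0" | "p = 0" "q \<noteq> 0" | "p \<noteq> 0" by blast
  then show ?thesis
  proof cases
    case 1
    then have "has_table s m A13 x w"
      by (simp add: prods table_simps)
    then show ?thesis using ind by (auto simp: assoc_types_def w_def)
  next
    case 2
    \<comment> \<open>Here \<open>x w = q w\<close> and \<open>w w = q^2 w\<close>, so
      \<open>w / q^2\<close> is idempotent and \<open>x - w / q\<close> annihilates the
      algebra.\<close>
    define e where "e = s (1 / q\<^sup>2) w"
    define n where "n = x - s (1 / q) w"
    have "has_table s m A3_1_0_0 e n"
      using 2 by (simp add: prods table_simps e_def n_def power2_eq_square algebra_simps)
    moreover have "indep e n"
      unfolding indep_def
    proof (intro allI impI)
      fix a b assume "s a e + s b n = 0"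
      then have "s b x + s (a / q\<^sup>2 - b / q) w = 0" by (simp add: e_def n_def algebra_simps)
      from coeff[OF this] 2 show "a = 0 \<and> b = 0" by auto
    qed
    ultimately show ?thesis by (auto simp: assoc_types_def)
  next
    case 3
    \<comment> \<open>\<open>i\<close> is the unit; subtracting \<open>q / 2\<close> from \<open>x\<close> completes the square in \<open>x\<^sup>2 - q x - p = 0\<close>.\<close>
    define i where "i = s (1 / p) (w - s q x)"
    define y where "y = x - s (q / 2) i"
    have pi: "w = s p i + s q x" using 3 by (simp add: i_def)
    have ix: "m i x = x" "m x i = x"
      using 3 by (simp_all add: i_def prods algebra_simps)
    have "m i w = w" "m w i = w"
      using ix by (simp_all add: w_def assoc[symmetric]) (simp add: assoc)
    then have ii: "m i i = i" using ix by (simp add: i_def)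
    have half: "s (1/2) z + s (1/2) z = z" for z
      using two by (simp add: scale_left_distrib[symmetric])
    have yy: "m y y = s (p + q\<^sup>2 / 4) i"
    proof -
      have "m y y = w - s (q/2) x - s (q/2) x + s (q\<^sup>2 / 4) i"
        using ix ii by (simp add: y_def w_def[symmetric] power2_eq_square algebra_simps)
      also have "\<dots> = s p i + s (q\<^sup>2 / 4) i + (s q x - s (q/2) x - s (q/2) x)"
        unfolding pi by (simp add: algebra_simps)
      also have "s q x - s (q/2) x - s (q/2) x = 0"
        using two by (simp add: scale_left_diff_distrib[symmetric] field_simps del: scale_left_diff_distrib)
      finally show ?thesis by (simp add: scale_left_distrib)
    qed
    \<comment> \<open>The first basis vector is \<open>i / 2\<close>, so
      \<open>y y = (p + q^2/4) i\<close> has twice that coefficient in the table.\<close>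
    have "has_table s m (A3_half_half (2 * (p + q\<^sup>2 / 4))) (s (1/2) i) y"
      using two ix ii by (simp add: yy table_simps) (simp add: y_def algebra_simps)
    moreover have "indep (s (1/2) i) y"
      unfolding indep_def
    proof (intro allI impI)
      fix a b assume "s a (s (1/2) i) + s b y = 0"
      \<comment> \<open>Substituting \<open>i = (w - q x) / p\<close> returns to the independent
        pair \<open>x\<close>, \<open>w\<close>.\<close>
      then have "s (b - (a - b * q) / 2 / p * q) x + s ((a - b * q) / 2 / p) w = 0"
        by (simp add: y_def i_def algebra_simps diff_divide_distrib)
      from coeff[OF this] 3 two show "a = 0 \<and> b = 0" by auto
    qed
    ultimately show ?thesis by (auto simp: assoc_types_def)
  qed
qed

text \<open>Since \<open>f\<close> is the sum of its four Peirce components and no multiple of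
  \<open>e\<close>, one component can replace it as second basis vector. The off-diagonal ones give
  the two noncommutative algebras, the diagonal ones contradict \<open>dep\<close>.\<close>

lemma idempotent_table:
  assumes two: "(2 :: 'a) \<noteq> 0" and e: "m e e = e" "e \<noteq> 0"
    and dep: "\<And>x. \<exists>c. m x x = s c x"
  shows "\<exists>A\<in>assoc_types. \<exists>u v. indep u v \<and> has_table s m A u v"
proof -
  have ee: "m e (m e z) = m e z" for z by (simp add: assoc[symmetric] e)
  obtain f where f: "indep e f" using ex_indep[OF e(2)] by blast
  \<comment> \<open>The digits are the scalars by which \<open>e\<close> acts on the left and on the
    right; \<open>f10\<close> is \<open>e f (1 - e)\<close> with a formal unit, and likewise for the
    others.\<close>
  define f11 f10 f01 f00 where "f11 = m e (m f e)" and "f10 = m e f - m e (m f e)"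
    and "f01 = m f e - m e (m f e)" and "f00 = f - m e f - m f e + m e (m f e)"
  have sum: "f = f11 + f10 + f01 + f00" by (simp add: f11_def f10_def f01_def f00_def)
  have "\<not> ((\<exists>c. f11 = s c e) \<and> (\<exists>c. f10 = s c e) \<and> (\<exists>c. f01 = s c e) \<and> (\<exists>c. f00 = s c e))"
  proof
    assume "(\<exists>c. f11 = s c e) \<and> (\<exists>c. f10 = s c e) \<and> (\<exists>c. f01 = s c e) \<and> (\<exists>c. f00 = s c e)"
    then obtain c1 c2 c3 c4 where "f = s (c1 + c2 + c3 + c4) e"
      using sum by (metis scale_left_distrib)
    then have "s (- (c1 + c2 + c3 + c4)) e + s 1 f = 0"
      by (simp only: scale_minus_left scale_one left_minus)
    with f show False unfolding indep_def by (metis zero_neq_one)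
  qed
  then have cases: "indep e f11 \<or> indep e f10 \<or> indep e f01 \<or> indep e f00"
    using e(2) indepI by metis
  \<comment> \<open>If \<open>g\<close> lies in a diagonal Peirce component, the squares of \<open>e + g\<close> and \<open>e - g\<close> cannot both be
    multiples of \<open>e + g\<close> and \<open>e - g\<close>.\<close>
  have contra: False if ind: "indep e g" and g: "m e g = s k g" "m g e = s k g" and k: "k = 0 \<or> k = 1" for g k
  proof -
    obtain l where l: "m g g = s l g" using dep by blast
    \<comment> \<open>In the square of \<open>e + t g\<close> the coefficient of \<open>e\<close>
      gives \<open>c = 1\<close>; the equation is then the one for the coefficient of
      \<open>g\<close>.\<close>
    have "2 * k * t + t\<^sup>2 * l = t" for t
    proof -
      obtain c where "m (e + s t g) (e + s t g) = s c (e + s t g)" using dep by blast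
      then have "s (1 - c) e + (s (k * t) g + s (k * t) g + s (t\<^sup>2 * l) g - s (c * t) g) = 0"
        by (simp add: e g l power2_eq_square algebra_simps)
      then have "s (1 - c) e + s (k * t + k * t + t\<^sup>2 * l - c * t) g = 0"
        by (simp only: scale_left_distrib scale_left_diff_distrib)
      from indepD[OF ind this] show ?thesis by simp algebra
    qed
    \<comment> \<open>Subtracting the two instances eliminates \<open>l\<close> and leaves
      \<open>k = 1/2\<close>.\<close>
    from this[of 1] this[of "-1"] have "2 * (2 * k) = 2 * 1" by simp algebra
    then have "2 * k = 1" using two by (metis mult_left_cancel)
    with k show False by (metis add_cancel_left_left mult.right_neutral mult_zero_right one_add_one zero_neq_one)
  qed
  from cases consider "indep e f11" | "indep e f10" | "indep e f01" | "indep e f00" by blast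
  then show ?thesis
  proof cases
    case 1
    have "m e f11 = s 1 f11" "m f11 e = s 1 f11"
      by (simp_all add: f11_def ee assoc e)
    from contra[OF 1 this] show ?thesis by simp
  next
    case 2
    have ef: "m e f10 = f10" "m f10 e = 0"
      by (simp_all add: f10_def ee assoc e)
    \<comment> \<open>The left side is 0 and the right side is \<open>f10 f10\<close>.\<close>
    have "m (m f10 e) f10 = m f10 (m e f10)" by (rule assoc)
    then have "m f10 f10 = 0" by (simp add: ef)
    then have "has_table s m A3_1_0_1 e f10" using ef e by (simp add: table_simps)
    with 2 show ?thesis by (auto simp: assoc_types_def)
  next
    case 3
    have ef: "m e f01 = 0" "m f01 e = f01"
      by (simp_all add: f01_def ee assoc e)
    have "m (m f01 e) f01 = m f01 (m e f01)" by (rule assoc)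
    then have "m f01 f01 = 0" by (simp add: ef)
    then have "has_table s m A3_half_0_0 (s (1/2) e) f01" using ef e by (simp add: table_simps)
    moreover have "indep (s (1/2) e) f01"
      unfolding indep_def
    proof (intro allI impI)
      fix a b assume "s a (s (1/2) e) + s b f01 = 0"
      then have "s (a * (1/2)) e + s b f01 = 0" by simp
      from indepD[OF 3 this] two show "a = 0 \<and> b = 0" by simp
    qed
    ultimately show ?thesis by (auto simp: assoc_types_def)
  next
    case 4
    have "m e f00 = s 0 f00" "m f00 e = s 0 f00"
      by (simp_all add: f00_def ee assoc e)
    from contra[OF 4 this] show ?thesis by simp
  qed
qed

text \<open>Without a cyclic generator every square is some \<open>c x\<close>, and a nonzero one
  makes \<open>x / c\<close> idempotent. If all squares vanished, associativity would make all
  products vanish.\<close>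

theorem ex_table:
  assumes two: "(2 :: 'a) \<noteq> 0" and nontriv: "nontrivial_mult m"
  shows "\<exists>A\<in>assoc_types. \<exists>u v. indep u v \<and> has_table s m A u v"
proof (cases "\<exists>x. indep x (m x x)")
  case True
  then show ?thesis using cyclic_table[OF two] by blast
next
  case False
  have dep: "\<exists>c. m x x = s c x" for x
    using False indepI[of x "m x x"] by (cases "x = 0") auto
  have "\<exists>x. m x x \<noteq> 0"
  proof (rule ccontr)
    assume "\<nexists>x. m x x \<noteq> 0"
    then have sq: "m x x = 0" for x by blast
    have anti: "m x y = - m y x" for x y
    proof -
      have "m (x + y) (x + y) = 0" by (rule sq)
      then have "m x y + m y x = 0" unfolding mult_simps by (simp add: sq add.commute)
      then show ?thesis by (simp add: eq_neg_iff_add_eq_0)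
    qed
    have "m x y = 0" for x y
    proof (cases "indep x y")
      case True
      obtain p q where pq: "m x y = s p x + s q y" using ex_coords[OF True] by blast
      \<comment> \<open>Inserting \<open>x y = p x + q y\<close> turns these into
        \<open>q (x y) = 0\<close> and \<open>p (x y) = 0\<close>, so a nonzero \<open>x y\<close>
        would have \<open>p = q = 0\<close>.\<close>
      have "m x (m x y) = 0" "m (m x y) y = 0" by (simp_all add: assoc[symmetric] sq) (simp add: assoc sq)
      then have "s q (m x y) = 0" "s p (m x y) = 0"
        by (simp_all add: pq sq del: scale_eq_0_iff)
      then show ?thesis using pq by auto
    next
      case False
      then consider "x = 0" | c where "y = s c x" using indepI by blast
      then show ?thesis by cases (simp_all add: sq)
    qed
    then show False using nontriv by (auto simp: nontrivial_mult_def)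
  qed
  then obtain x c where x: "m x x = s c x" "m x x \<noteq> 0" using dep by metis
  then have "c \<noteq> 0" "x \<noteq> 0" by auto
  then have "m (s (1 / c) x) (s (1 / c) x) = s (1 / c) x" "s (1 / c) x \<noteq> 0"
    using x(1) by simp_all
  then show ?thesis using idempotent_table[OF two _ _ dep] by blast
qed

end

section \<open>Canonical forms\<close>

lemma A3_half_half_eq_iff [simp]: "A3_half_half \<alpha> = A3_half_half \<beta> \<longleftrightarrow> \<alpha> = \<beta>"
proof
  assume "A3_half_half \<alpha> = A3_half_half \<beta>"
  then have "A3_half_half \<alpha> $ 1 $ 4 = A3_half_half \<beta> $ 1 $ 4" by simp
  then show "\<alpha> = \<beta>" by (simp add: A3_half_half_def vector_4)
qed simp

lemma assoc_types_distinct: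
  assumes "(2 :: 'a::field) \<noteq> 0"
  shows "(A3_1_0_0 :: 'a^4^2) \<noteq> A3_1_0_1" "(A3_1_0_0 :: 'a^4^2) \<noteq> A3_half_0_0"
    "(A3_1_0_0 :: 'a^4^2) \<noteq> A13" "A3_1_0_0 \<noteq> A3_half_half (\<alpha> :: 'a)"
    "(A3_1_0_1 :: 'a^4^2) \<noteq> A3_half_0_0" "(A3_1_0_1 :: 'a^4^2) \<noteq> A13"
    "A3_1_0_1 \<noteq> A3_half_half (\<alpha> :: 'a)" "(A3_half_0_0 :: 'a^4^2) \<noteq> A13"
    "A3_half_0_0 \<noteq> A3_half_half (\<alpha> :: 'a)" "A13 \<noteq> A3_half_half (\<alpha> :: 'a)"
  using mult_invariants_types[OF assms]
  by (metis (no_types) prod.inject)+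

lemma assoc_types_eq:
  fixes A B :: "'a::field^4^2"
  assumes "(2 :: 'a) \<noteq> 0" "A \<in> assoc_types" "B \<in> assoc_types"
    and "mult_invariants (sc_mult A) = mult_invariants (sc_mult B)"
  obtains "A = B" "A \<in> {A3_1_0_0, A3_1_0_1, A3_half_0_0, A13}"
  | \<alpha> \<beta> where "A = A3_half_half \<alpha>" "B = A3_half_half \<beta>"
  using assms(2-4) unfolding assoc_types_def
  by (auto simp: mult_invariants_types[OF assms(1)])

section \<open>Normal forms of Gram matrices\<close>

text \<open>Common shape of the rules \<open>c1\<close> to \<open>c3\<close> and \<open>c12\<close>
  to \<open>c14\<close>, where \<open>b\<close>, \<open>c\<close> scale by \<open>t\<close> and
  \<open>d\<close> by \<open>t^2\<close>.\<close>

definition scaling_form :: "'a::field \<Rightarrow> 'a \<Rightarrow> 'a \<Rightarrow> 'a \<Rightarrow> bool" where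
  "scaling_form a b c d \<longleftrightarrow>
     b = 1 \<and> a * d - c \<noteq> 0 \<or> b = 0 \<and> (c = 1 \<or> c = 0) \<and> a * d \<noteq> 0"

text \<open>Common shape of \<open>c4\<close> to \<open>c7\<close> and \<open>c8\<close> to
  \<open>c11\<close>, where the shear by \<open>q\<close> acts as well.\<close>

definition affine_form :: "'a::field \<Rightarrow> 'a \<Rightarrow> 'a \<Rightarrow> 'a \<Rightarrow> bool" where
  "affine_form a b c d \<longleftrightarrow>
     b = 0 \<and> (c = 1 \<or> c = 0) \<and> a * d \<noteq> 0 \<or>
     b = 1 \<and> d = 0 \<and> (a = 0 \<and> c \<noteq> 0 \<and> c + 1 \<noteq> 0 \<or> c = -1)"

text \<open>The rules \<open>c16\<close> to \<open>c18\<close>. Only the shear is used up; the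
  scaling by \<open>p\<close> survives in the identifications.\<close>

definition nil_form :: "'a::field \<Rightarrow> 'a \<Rightarrow> 'a \<Rightarrow> 'a \<Rightarrow> bool" where
  "nil_form a b c d \<longleftrightarrow>
     b = 0 \<and> a * d \<noteq> 0 \<or> d = 0 \<and> b * c \<noteq> 0 \<and> (a = 0 \<and> b + c \<noteq> 0 \<or> c = -b)"

lemma canonical_pairs_iff:
  fixes a :: "'a::field"
  assumes two: "(2 :: 'a) \<noteq> 0"
  shows "(A3_1_0_0, mat22 a b c d) \<in> canonical_pairs R \<longleftrightarrow> scaling_form a b c d"
    and "(A3_1_0_1, mat22 a b c d) \<in> canonical_pairs R \<longleftrightarrow> affine_form a b c d"
    and "(A3_half_0_0, mat22 a b c d) \<in> canonical_pairs R \<longleftrightarrow> affine_form a b c d"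
    and "(A13, mat22 a b c d) \<in> canonical_pairs R \<longleftrightarrow> nil_form a b c d"
    and "(A3_half_half \<alpha>, mat22 a b c d) \<in> canonical_pairs R \<longleftrightarrow>
       (if \<alpha> = 0 then scaling_form a b c d else \<alpha> \<in> R \<and> a * d - b * c \<noteq> 0)"
proof -
  note distinct = assoc_types_distinct[OF two] assoc_types_distinct[OF two, symmetric]
  show "(A3_1_0_0, mat22 a b c d) \<in> canonical_pairs R \<longleftrightarrow> scaling_form a b c d"
    by (subst canonical_pairs.simps) (auto simp: distinct scaling_form_def)
  show "(A3_1_0_1, mat22 a b c d) \<in> canonical_pairs R \<longleftrightarrow> affine_form a b c d"
    by (subst canonical_pairs.simps) (auto simp: distinct affine_form_def)
  show "(A3_half_0_0, mat22 a b c d) \<in> canonical_pairs R \<longleftrightarrow> affine_form a b c d"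
    by (subst canonical_pairs.simps) (auto simp: distinct affine_form_def)
  show "(A13, mat22 a b c d) \<in> canonical_pairs R \<longleftrightarrow> nil_form a b c d"
    by (subst canonical_pairs.simps) (auto simp: distinct nil_form_def)
  show "(A3_half_half \<alpha>, mat22 a b c d) \<in> canonical_pairs R \<longleftrightarrow>
       (if \<alpha> = 0 then scaling_form a b c d else \<alpha> \<in> R \<and> a * d - b * c \<noteq> 0)"
    by (subst canonical_pairs.simps) (auto simp: distinct scaling_form_def)
qed

lemma canonical_pairsD:
  assumes "(A, S) \<in> canonical_pairs R"
  shows "A \<in> assoc_types" "S $ 1 $ 1 * S $ 2 $ 2 - S $ 1 $ 2 * S $ 2 $ 1 \<noteq> 0"
  using assms by (auto simp: assoc_types_def elim!: canonical_pairs.cases)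

text \<open>Take \<open>t\<close> to be the first nonzero one of \<open>b\<close>, \<open>c\<close>,
  which turns that entry into 1.\<close>

lemma scaling_form_exists:
  fixes a :: "'a::field"
  assumes "a * d - b * c \<noteq> 0"
  obtains t b' c' d' where "t \<noteq> 0" "b = t * b'" "c = t * c'" "d = t\<^sup>2 * d'" "scaling_form a b' c' d'"
proof -
  consider "b \<noteq> 0" | "b = 0" "c \<noteq> 0" | "b = 0" "c = 0" by blast
  then show ?thesis
  proof cases
    case 1
    have "a * (d / b\<^sup>2) - c / b = (a * d - b * c) / b\<^sup>2"
      using 1 by (simp add: field_simps power2_eq_square)
    then show ?thesis
      using 1 assms by (intro that[of b 1 "c / b" "d / b\<^sup>2"]) (simp_all add: scaling_form_def)
  next
    case 2
    then show ?thesis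
      using assms by (intro that[of c 0 1 "d / c\<^sup>2"]) (simp_all add: scaling_form_def)
  next
    case 3
    then show ?thesis
      using assms by (intro that[of 1 0 0 d]) (simp_all add: scaling_form_def)
  qed
qed

text \<open>If \<open>d\<close> is nonzero, the shear clears \<open>b\<close> and turns
  \<open>a\<close> into the determinant divided by \<open>d\<close>; the shear does not change
  \<open>c - b\<close>, so this is what gets scaled to 1. If \<open>d = 0\<close>, the shear moves
  \<open>a\<close> by multiples of \<open>b + c\<close> and clears it unless
  \<open>b + c = 0\<close>.\<close>

lemma affine_form_exists:
  fixes a :: "'a::field"
  assumes det: "a * d - b * c \<noteq> 0"
  obtains q t a' b' c' d' where "t \<noteq> 0" "a = a' + q * (b' + c') + q\<^sup>2 * d'" "b = t * (b' + q * d')"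
    "c = t * (c' + q * d')" "d = t\<^sup>2 * d'" "affine_form a' b' c' d'"
proof -
  have lead: "a - b * c / d \<noteq> 0" if "d \<noteq> 0" using det that by (simp add: field_simps)
  consider "d \<noteq> 0" "b \<noteq> c" | "d \<noteq> 0" "b = c" | "d = 0" "b + c \<noteq> 0" | "d = 0" "b + c = 0" by blast
  then show ?thesis
  proof cases
    case 1
    define t where "t = c - b"
    have t: "t \<noteq> 0" "c = b + t" using 1 by (simp_all add: t_def)
    have form: "affine_form (a - b * c / d) 0 1 (d / t\<^sup>2)"
      using 1 t lead by (simp add: affine_form_def)
    show ?thesis
      by (rule that[OF _ _ _ _ _ form, of t "b * t / d"])
        (use 1 t in \<open>simp_all add: field_simps power2_eq_square\<close>)
  next
    case 2
    have form: "affine_form (a - b * c / d) 0 0 d"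
      using 2 lead by (simp add: affine_form_def)
    show ?thesis
      by (rule that[OF _ _ _ _ _ form, of 1 "b / d"])
        (use 2 in \<open>simp_all add: field_simps power2_eq_square\<close>)
  next
    case 3
    then have bc: "b \<noteq> 0" "c \<noteq> 0" using det by auto
    have *: "1 + c / b = (b + c) / b" using bc by (simp add: field_simps)
    show ?thesis
      by (rule that[of b 0 "a * b / (b + c)" 1 "c / b" 0])
        (use 3 bc * in \<open>simp_all add: affine_form_def add.commute[of "c / b"]\<close>)
  next
    case 4
    then have "b \<noteq> 0" "c = - b" using det by (auto simp: add_eq_0_iff2)
    then show ?thesis
      using 4 by (intro that[of b a 0 1 "-1" 0]) (simp_all add: affine_form_def)
  qed
qed

text \<open>The shears of \<open>affine_form_exists\<close> without scaling; for \<open>d\<close>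
  nonzero, \<open>c - b\<close> stays as a parameter.\<close>

lemma nil_form_exists:
  fixes a :: "'a::field"
  assumes det: "a * d - b * c \<noteq> 0"
  obtains q a' b' c' where "a = a' + q * (b' + c') + q\<^sup>2 * d" "b = b' + q * d"
    "c = c' + q * d" "nil_form a' b' c' d"
proof -
  consider "d \<noteq> 0" | "d = 0" "b + c \<noteq> 0" | "d = 0" "b + c = 0" by blast
  then show ?thesis
  proof cases
    case 1
    then have form: "nil_form (a - b * c / d) 0 (c - b) d"
      using det by (simp add: nil_form_def field_simps)
    show ?thesis
      by (rule that[OF _ _ _ form, of "b / d"])
        (use 1 in \<open>simp_all add: field_simps power2_eq_square\<close>)
  next
    case 2
    then show ?thesis
      using det by (intro that[of 0 "a / (b + c)" b c]) (simp_all add: nil_form_def)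
  next
    case 3
    then have "b \<noteq> 0" "c = - b" using det by (auto simp: add_eq_0_iff2)
    then show ?thesis
      using 3 by (intro that[of a 0 b c]) (simp_all add: nil_form_def)
  qed
qed

lemma canonical_pair_exists:
  fixes A :: "'a::field^4^2"
  assumes two: "(2 :: 'a) \<noteq> 0" and R: "alpha4_representatives R"
    and A: "A \<in> assoc_types" and det: "S $ 1 $ 1 * S $ 2 $ 2 - S $ 1 $ 2 * S $ 2 $ 1 \<noteq> 0"
  shows "\<exists>(B, T)\<in>canonical_pairs R. iso_cart A S B T"
proof -
  obtain a b c d where S: "S = mat22 a b c d" using mat22_collapse[of S] by metis
  with det have det': "a * d - b * c \<noteq> 0" by simp
  note canonical = canonical_pairs_iff[OF two]
  have "\<exists>B a' b' c' d'. (B, mat22 a' b' c' d') \<in> canonical_pairs R \<and> iso_cart A S B (mat22 a' b' c' d')"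
  proof -
    consider "A = A3_1_0_0" | "A = A3_1_0_1" | "A = A3_half_0_0" | "A = A13"
      | "A = A3_half_half 0" | \<alpha> where "A = A3_half_half \<alpha>" "\<alpha> \<noteq> 0"
      using A unfolding assoc_types_def by blast
    then show ?thesis
    proof cases
      case 1
      obtain t b' c' d' where "t \<noteq> 0" "b = t * b'" "c = t * c'" "d = t\<^sup>2 * d'" "scaling_form a b' c' d'"
        using scaling_form_exists[OF det'] .
      then show ?thesis unfolding 1 S using canonical(1) iso_A3_1_0_0 by blast
    next
      case 2
      obtain q t a' b' c' d' where "t \<noteq> 0" "a = a' + q * (b' + c') + q\<^sup>2 * d'" "b = t * (b' + q * d')"
        "c = t * (c' + q * d')" "d = t\<^sup>2 * d'" "affine_form a' b' c' d'"
        using affine_form_exists[OF det'] .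
      then show ?thesis unfolding 2 S using canonical(2) iso_A3_1_0_1 by blast
    next
      case 3
      obtain q t a' b' c' d' where "t \<noteq> 0" "a = a' + q * (b' + c') + q\<^sup>2 * d'" "b = t * (b' + q * d')"
        "c = t * (c' + q * d')" "d = t\<^sup>2 * d'" "affine_form a' b' c' d'"
        using affine_form_exists[OF det'] .
      then show ?thesis unfolding 3 S using canonical(3) iso_A3_half_0_0[OF two] by blast
    next
      case 4
      obtain q a' b' c' where "a = a' + q * (b' + c') + q\<^sup>2 * d" "b = b' + q * d"
        "c = c' + q * d" and nf: "nil_form a' b' c' d"
        using nil_form_exists[OF det'] .
      then have "iso_cart A S A13 (mat22 a' b' c' d)"
        unfolding 4 S iso_A13 by (intro exI[of _ 1] exI[of _ q]) simp
      with nf show ?thesis using canonical(4) by blast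
    next
      case 5
      obtain t b' c' d' where t: "t \<noteq> 0" "b = t * b'" "c = t * c'" "d = t\<^sup>2 * d'" and sf: "scaling_form a b' c' d'"
        using scaling_form_exists[OF det'] .
      have "iso_cart A S (A3_half_half 0) (mat22 a b' c' d')"
        unfolding 5 S iso_A3_half_half[OF two] using t by auto
      moreover have "(A3_half_half 0, mat22 a b' c' d') \<in> canonical_pairs R"
        using sf by (simp add: canonical)
      ultimately show ?thesis by blast
    next
      case 6
      \<comment> \<open>Pass to the representative of the class of \<open>\<alpha>\<close> and carry
        the Gram matrix along with the same \<open>t\<close>.\<close>
      obtain r t where r: "r \<in> R" and t: "t \<noteq> 0" "\<alpha> = t\<^sup>2 * r"
        using R unfolding alpha4_representatives_def algebra_isomorphic_A3_half_half[OF two] by metis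
      have "iso_cart A S (A3_half_half r) (mat22 a (b / t) (c / t) (d / t\<^sup>2))"
        unfolding 6 S iso_A3_half_half[OF two] using t by (intro exI[of _ t]) simp
      moreover have "a * (d / t\<^sup>2) - b / t * (c / t) = (a * d - b * c) / t\<^sup>2"
        using t by (simp add: field_simps power2_eq_square)
      then have "(A3_half_half r, mat22 a (b / t) (c / t) (d / t\<^sup>2)) \<in> canonical_pairs R"
        using r t 6 det' by (simp add: canonical)
      ultimately show ?thesis by blast
    qed
  qed
  then show ?thesis by blast
qed

section \<open>Identifications\<close>

text \<open>\<open>identified\<close> writes the second matrix in terms of the first, the
  isomorphism criteria the first in terms of the second; hence every case goes through the reversed
  isomorphism.\<close>

lemma identified_imp_iso:
  fixes A :: "'a::field^4^2"
  assumes two: "(2 :: 'a) \<noteq> 0" and "identified (A, S) (B, T)"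
  shows "iso_cart A S B T"
  using assms(2)
proof cases
  case (i3 a d t)
  have "iso_cart B T A S"
    unfolding i3 iso_A3_1_0_0
    by (rule exI[of _ t])
      (use i3 in \<open>simp add: power2_eq_square power3_eq_cube power4_eq_xxxx\<close>)
  then show ?thesis by (rule pairs_isomorphic_sym)
next
  case (i5 a d t)
  have "iso_cart B T A S"
    unfolding i5 iso_A3_1_0_1
    by (rule exI[of _ 0], rule exI[of _ t])
      (use i5 in \<open>simp add: power2_eq_square power3_eq_cube power4_eq_xxxx\<close>)
  then show ?thesis by (rule pairs_isomorphic_sym)
next
  case (i9 a d t)
  have "iso_cart B T A S"
    unfolding i9 iso_A3_half_0_0[OF two]
    by (rule exI[of _ 0], rule exI[of _ t])
      (use i9 in \<open>simp add: power2_eq_square power3_eq_cube power4_eq_xxxx\<close>)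
  then show ?thesis by (rule pairs_isomorphic_sym)
next
  case (i14 a d t)
  have "iso_cart B T A S"
    unfolding i14 iso_A3_half_half[OF two]
    by (rule exI[of _ t])
      (use i14 in \<open>simp add: power2_eq_square power3_eq_cube power4_eq_xxxx\<close>)
  then show ?thesis by (rule pairs_isomorphic_sym)
next
  case (i15 \<alpha> a d b c)
  have "iso_cart B T A S"
    unfolding i15 iso_A3_half_half[OF two]
    by (rule exI[of _ "-1"])
      (use i15 in \<open>simp add: power2_eq_square power3_eq_cube power4_eq_xxxx\<close>)
  then show ?thesis by (rule pairs_isomorphic_sym)
next
  case (i16 a d p c)
  have "iso_cart B T A S"
    unfolding i16 iso_A13
    by (rule exI[of _ p], rule exI[of _ 0])
      (use i16 in \<open>simp add: power2_eq_square power3_eq_cube power4_eq_xxxx\<close>)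
  then show ?thesis by (rule pairs_isomorphic_sym)
next
  case (i17 b c p)
  have "iso_cart B T A S"
    unfolding i17 iso_A13
    by (rule exI[of _ p], rule exI[of _ 0])
      (use i17 in \<open>simp add: power2_eq_square power3_eq_cube power4_eq_xxxx\<close>)
  then show ?thesis by (rule pairs_isomorphic_sym)
next
  case (i18 b p a)
  have "iso_cart B T A S"
    unfolding i18 iso_A13
    by (rule exI[of _ p], rule exI[of _ 0])
      (use i18 in \<open>simp add: power2_eq_square power3_eq_cube power4_eq_xxxx\<close>)
  then show ?thesis by (rule pairs_isomorphic_sym)
qed

lemma equivclp_identified_imp_iso:
  fixes A :: "'a::field^4^2"
  assumes two: "(2 :: 'a) \<noteq> 0" and "equivclp identified (A, S) (B, T)"
  shows "iso_cart A S B T"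
proof -
  have "iso_cart A S (fst P) (snd P)" if "equivclp identified (A, S) P" for P
    using that
  proof induction
    case base
    show ?case by (simp add: pairs_isomorphic_refl vec.vector_space_axioms)
  next
    case (step P Q)
    have "iso_cart (fst P) (snd P) (fst Q) (snd Q)"
      using step.hyps(2) identified_imp_iso[OF two, of "fst P" "snd P" "fst Q" "snd Q"]
        identified_imp_iso[OF two, of "fst Q" "snd Q" "fst P" "snd P"]
      by (auto intro: pairs_isomorphic_sym)
    with step.IH show ?case by (rule pairs_isomorphic_trans)
  qed
  from this[OF assms(2)] show ?thesis by simp
qed

section \<open>Uniqueness of the normal forms\<close>

text \<open>An off-diagonal entry normalised to 1 forces \<open>t = 1\<close>; \<open>t\<close> is
  free only for diagonal matrices.\<close>

lemma scaling_form_unique: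
  assumes "scaling_form a b c d" "scaling_form a b' c' d'"
    and "t \<noteq> 0" "b = t * b'" "c = t * c'" "d = t\<^sup>2 * d'"
  shows "(b = b' \<and> c = c' \<and> d = d') \<or> (b = 0 \<and> b' = 0 \<and> c = 0 \<and> c' = 0 \<and> a * d' \<noteq> 0)"
  using assms by (auto simp: scaling_form_def)

text \<open>For \<open>d'\<close> nonzero, \<open>b = b' = 0\<close> forces \<open>q = 0\<close> and
  only the scaling is left. For \<open>d' = 0\<close>, \<open>b = b' = 1\<close> forces
  \<open>t = 1\<close>, and \<open>a\<close> moves by \<open>q (1 + c')\<close>: either
  \<open>c' = -1\<close>, or \<open>a\<close> and \<open>a'\<close> are both 0.\<close>

lemma affine_form_unique:
  assumes "affine_form a b c d" "affine_form a' b' c' d'"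
    and "t \<noteq> 0" "a = a' + q * (b' + c') + q\<^sup>2 * d'" "b = t * (b' + q * d')"
    "c = t * (c' + q * d')" "d = t\<^sup>2 * d'"
  shows "a = a'" "(b = b' \<and> c = c' \<and> d = d') \<or> (b = 0 \<and> b' = 0 \<and> c = 0 \<and> c' = 0 \<and> a' * d' \<noteq> 0)"
  using assms by (auto simp: affine_form_def add.commute)

lemma nil_form_unique:
  assumes "nil_form a b c d" "nil_form a' b' c' d'"
    and p: "p \<noteq> 0" and eqs: "a = p\<^sup>2 * a' + p * q * (b' + c') + q\<^sup>2 * d'" "b = p\<^sup>2 * (p * b' + q * d')"
    "c = p\<^sup>2 * (p * c' + q * d')" "d = p ^ 4 * d'"
  shows "identified (A13, mat22 a' b' c' d') (A13, mat22 a b c d)"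
proof -
  \<comment> \<open>A nonzero \<open>d'\<close> makes \<open>d\<close> nonzero, hence
    \<open>b = b' = 0\<close>, and the equation for \<open>b\<close> yields
    \<open>q d' = 0\<close>.\<close>
  have qd: "q * d' = 0" using assms by (auto simp: nil_form_def)
  then have *: "b = p ^ 3 * b'" "c = p ^ 3 * c'" "a = p\<^sup>2 * a' + p * q * (b' + c')"
    using eqs by (auto simp: power2_eq_square power3_eq_cube)
  consider "b' = 0" "a' * d' \<noteq> 0" | "d' = 0" "b' * c' \<noteq> 0" "a' = 0" "b' + c' \<noteq> 0"
    | "d' = 0" "b' * c' \<noteq> 0" "c' = - b'"
    using assms(2) by (auto simp: nil_form_def)
  then show ?thesis
  proof cases
    case 1
    then have "q = 0" using qd by auto
    with 1 * eqs(4) p show ?thesis by (simp add: i16)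
  next
    case 2
    have "p ^ 3 * b' + p ^ 3 * c' \<noteq> 0" using 2 p by (simp add: distrib_left[symmetric])
    then have "a = 0" using assms(1) 2 p * eqs(4) by (auto simp: nil_form_def)
    with 2 * eqs(4) p show ?thesis by (simp add: i17)
  next
    case 3
    with * eqs(4) p show ?thesis by (simp add: i18)
  qed
qed

text \<open>The normal forms are sharp enough that no chain arises: the pairs are equal or related
  by one rule, in one direction or the other.\<close>

lemma iso_imp_equivclp_identified:
  fixes A :: "'a::field^4^2"
  assumes two: "(2 :: 'a) \<noteq> 0" and R: "alpha4_representatives R"
    and AS: "(A, S) \<in> canonical_pairs R" and BT: "(B, T) \<in> canonical_pairs R"
    and iso: "iso_cart A S B T"
  shows "equivclp identified (A, S) (B, T)"
proof -
  obtain a b c d where S: "S = mat22 a b c d" using mat22_collapse[of S] by metis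
  obtain a' b' c' d' where T: "T = mat22 a' b' c' d'" using mat22_collapse[of T] by metis
  note canonical = canonical_pairs_iff[OF two]
  have "(A, S) = (B, T) \<or> identified (A, S) (B, T) \<or> identified (B, T) (A, S)"
  proof (rule assoc_types_eq[OF two canonical_pairsD(1)[OF AS] canonical_pairsD(1)[OF BT] mult_invariants_eq[OF iso]])
    assume B: "A = B" and "A \<in> {A3_1_0_0, A3_1_0_1, A3_half_0_0, A13}"
    then consider "A = A3_1_0_0" | "A = A3_1_0_1" | "A = A3_half_0_0" | "A = A13" by blast
    then show ?thesis
    proof cases
      case 1
      obtain t where t: "t \<noteq> 0" "a = a'" "b = t * b'" "c = t * c'" "d = t\<^sup>2 * d'"
        using iso unfolding 1 B[symmetric] S T iso_A3_1_0_0 by blast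
      have "scaling_form a b c d" "scaling_form a b' c' d'"
        using AS BT t unfolding 1 B[symmetric] S T canonical by auto
      from scaling_form_unique[OF this t(1,3-)] show ?thesis
      proof (elim disjE)
        assume "b = b' \<and> c = c' \<and> d = d'"
        then show ?thesis using t by (simp add: B[symmetric] 1 S T)
      next
        assume "b = 0 \<and> b' = 0 \<and> c = 0 \<and> c' = 0 \<and> a * d' \<noteq> 0"
        then show ?thesis using i3[of a d' t] t by (simp add: B[symmetric] 1 S T)
      qed
    next
      case 2
      obtain q t where t: "t \<noteq> 0" "a = a' + q * (b' + c') + q\<^sup>2 * d'" "b = t * (b' + q * d')"
        "c = t * (c' + q * d')" "d = t\<^sup>2 * d'"
        using iso unfolding 2 B[symmetric] S T iso_A3_1_0_1 by blast
      have forms: "affine_form a b c d" "affine_form a' b' c' d'"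
        using AS BT unfolding 2 B[symmetric] S T canonical by auto
      note a = affine_form_unique(1)[OF forms t]
      from affine_form_unique(2)[OF forms t] show ?thesis
      proof (elim disjE)
        assume "b = b' \<and> c = c' \<and> d = d'"
        then show ?thesis using t a by (simp add: B[symmetric] 2 S T)
      next
        assume "b = 0 \<and> b' = 0 \<and> c = 0 \<and> c' = 0 \<and> a' * d' \<noteq> 0"
        then show ?thesis using i5[of a' d' t] t(1,5) a by (simp add: B[symmetric] 2 S T)
      qed
    next
      case 3
      obtain q t where t: "t \<noteq> 0" "a = a' + q * (b' + c') + q\<^sup>2 * d'" "b = t * (b' + q * d')"
        "c = t * (c' + q * d')" "d = t\<^sup>2 * d'"
        using iso unfolding 3 B[symmetric] S T iso_A3_half_0_0[OF two] by blast
      have forms: "affine_form a b c d" "affine_form a' b' c' d'"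
        using AS BT unfolding 3 B[symmetric] S T canonical by auto
      note a = affine_form_unique(1)[OF forms t]
      from affine_form_unique(2)[OF forms t] show ?thesis
      proof (elim disjE)
        assume "b = b' \<and> c = c' \<and> d = d'"
        then show ?thesis using t a by (simp add: B[symmetric] 3 S T)
      next
        assume "b = 0 \<and> b' = 0 \<and> c = 0 \<and> c' = 0 \<and> a' * d' \<noteq> 0"
        then show ?thesis using i9[of a' d' t] t(1,5) a by (simp add: B[symmetric] 3 S T)
      qed
    next
      case 4
      obtain p q where p: "p \<noteq> 0" "a = p\<^sup>2 * a' + p * q * (b' + c') + q\<^sup>2 * d'"
        "b = p\<^sup>2 * (p * b' + q * d')" "c = p\<^sup>2 * (p * c' + q * d')" "d = p ^ 4 * d'"
        using iso unfolding 4 B[symmetric] S T iso_A13 by blast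
      have "nil_form a b c d" "nil_form a' b' c' d'"
        using AS BT unfolding 4 B[symmetric] S T canonical by auto
      from nil_form_unique[OF this p] show ?thesis
        unfolding B[symmetric] 4 S T by blast
    qed
  next
    fix \<alpha> \<beta> assume A: "A = A3_half_half \<alpha>" and B: "B = A3_half_half \<beta>"
    obtain t where t: "t \<noteq> 0" "\<alpha> = t\<^sup>2 * \<beta>" "a = a'" "b = t * b'" "c = t * c'" "d = t\<^sup>2 * d'"
      using iso unfolding A B S T iso_A3_half_half[OF two] by blast
    show ?thesis
    proof (cases "\<alpha> = 0")
      case True
      then have \<beta>: "\<beta> = 0" using t by simp
      have "scaling_form a b c d" "scaling_form a b' c' d'"
        using AS BT t True \<beta> unfolding A B S T canonical by auto
      from scaling_form_unique[OF this t(1,4-)] show ?thesis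
      proof (elim disjE)
        assume "b = b' \<and> c = c' \<and> d = d'"
        then show ?thesis using t by (simp add: A B True \<beta> S T)
      next
        assume "b = 0 \<and> b' = 0 \<and> c = 0 \<and> c' = 0 \<and> a * d' \<noteq> 0"
        then show ?thesis using i14[of a d' t] t by (simp add: A B True \<beta> S T)
      qed
    next
      case False
      then have \<beta>: "\<beta> \<noteq> 0" using t by auto
      have mem: "\<alpha> \<in> R" "\<beta> \<in> R" and det: "a * d - b * c \<noteq> 0"
        using AS BT False \<beta> unfolding A B S T canonical by auto
      have "\<exists>s. s \<noteq> 0 \<and> \<alpha> = s\<^sup>2 * \<alpha>" by (intro exI[of _ 1]) simp
      \<comment> \<open>Both lie in \<open>R\<close> and represent the class of
        \<open>\<alpha>\<close>, so they coincide. This leaves \<open>t = 1\<close> or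
        \<open>t = -1\<close>, the sign change of \<open>i15\<close>.\<close>
      then have "\<alpha> = \<beta>"
        using R mem t(1,2) unfolding alpha4_representatives_def algebra_isomorphic_A3_half_half[OF two]
        by metis
      with t(2) False have "t\<^sup>2 = 1" by simp
      then consider "t = 1" | "t = -1" by (auto simp: power2_eq_1_iff)
      then show ?thesis
      proof cases
        case 1
        then show ?thesis using t \<open>\<alpha> = \<beta>\<close> by (simp add: A B S T)
      next
        case 2
        then have "b' = - b" "c' = - c" "d' = d" using t by auto
        then show ?thesis
          using i15[OF False det] t(3) \<open>\<alpha> = \<beta>\<close> by (simp add: A B S T)
      qed
    qed
  qed
  then show ?thesis by (metis converse_r_into_equivclp equivclp_refl r_into_equivclp)
qed

section \<open>Classification\<close>

lemma assoc_form_pair_cart: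
  fixes A :: "'a::field^4^2"
  assumes two: "(2 :: 'a) \<noteq> 0" and A: "A \<in> assoc_types"
    and det: "S $ 1 $ 1 * S $ 2 $ 2 - S $ 1 $ 2 * S $ 2 $ 1 \<noteq> 0"
  shows "assoc_form_pair (*s) (sc_mult A) (gram_form S)"
proof -
  note simps = vec2_eq_iff sc_mult_component vector_4
    A3_1_0_0_def A3_1_0_1_def A3_half_0_0_def A3_half_half_def A13_def
  have "sc_mult A (sc_mult A x y) z = sc_mult A x (sc_mult A y z)" for x y z
    using A unfolding assoc_types_def by (auto simp: simps field_simps)
  \<comment> \<open>The square of \<open>e1\<close> is a witness that works for all tables at
    once.\<close>
  moreover have "sc_mult A (vector [1, 0]) (vector [1, 0]) \<noteq> 0"
    using A two unfolding assoc_types_def by (auto simp: simps)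
  moreover have "x = 0" if "\<forall>y. gram_form S x y = 0" for x
  proof -
    have "x $ 1 * S $ 1 $ 1 + x $ 2 * S $ 2 $ 1 = 0" "x $ 1 * S $ 1 $ 2 + x $ 2 * S $ 2 $ 2 = 0"
      using that[rule_format, of "vector [1, 0]"] that[rule_format, of "vector [0, 1]"]
      by (simp_all add: gram_form_expand)
    \<comment> \<open>Multiplication by the adjugate of \<open>S\<close>.\<close>
    then have "x $ 1 * (S $ 1 $ 1 * S $ 2 $ 2 - S $ 1 $ 2 * S $ 2 $ 1) = 0"
      "x $ 2 * (S $ 1 $ 1 * S $ 2 $ 2 - S $ 1 $ 2 * S $ 2 $ 1) = 0" by algebra+
    with det show ?thesis by (simp add: vec2_eq_iff)
  qed
  moreover have "y = 0" if "\<forall>x. gram_form S x y = 0" for y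
  proof -
    have "S $ 1 $ 1 * y $ 1 + S $ 1 $ 2 * y $ 2 = 0" "S $ 2 $ 1 * y $ 1 + S $ 2 $ 2 * y $ 2 = 0"
      using that[rule_format, of "vector [1, 0]"] that[rule_format, of "vector [0, 1]"]
      by (simp_all add: gram_form_expand)
    then have "y $ 1 * (S $ 1 $ 1 * S $ 2 $ 2 - S $ 1 $ 2 * S $ 2 $ 1) = 0"
      "y $ 2 * (S $ 1 $ 1 * S $ 2 $ 2 - S $ 1 $ 2 * S $ 2 $ 1) = 0" by algebra+
    with det show ?thesis by (simp add: vec2_eq_iff)
  qed
  ultimately show ?thesis
    unfolding assoc_form_pair_def two_dim_assoc_algebra_def nontrivial_mult_def nondegenerate_bilinear_form_def
    by (auto simp: vec.vector_space_axioms bilinear_sc_mult bilinear_gram_form vec_dim_card simp del: vec.dim_UNIV)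
qed

lemma (in two_dim_algebra) gram_det_nonzero:
  assumes "nondegenerate_bilinear_form s \<sigma>" and ind: "indep u v"
  shows "\<sigma> u u * \<sigma> v v - \<sigma> u v * \<sigma> v u \<noteq> 0"
proof
  assume det: "\<sigma> u u * \<sigma> v v - \<sigma> u v * \<sigma> v u = 0"
  have \<sigma>: "bilinear_map s (*) \<sigma>" and nd: "\<And>x. \<forall>y. \<sigma> x y = 0 \<Longrightarrow> x = 0"
    using assms by (auto simp: nondegenerate_bilinear_form_def)
  note \<sigma>_simps = bilinear_mapD[OF \<sigma>]
  have rad: "p = 0 \<and> q = 0" if "p * \<sigma> u u + q * \<sigma> v u = 0" "p * \<sigma> u v + q * \<sigma> v v = 0" for p q
  proof -
    have "\<sigma> (s p u + s q v) y = 0" for y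
    proof -
      obtain c d where "y = s c u + s d v" using ex_coords[OF ind] .
      then have "\<sigma> (s p u + s q v) y = c * (p * \<sigma> u u + q * \<sigma> v u) + d * (p * \<sigma> u v + q * \<sigma> v v)"
        by (simp add: \<sigma>_simps algebra_simps)
      then show ?thesis using that by simp
    qed
    then show ?thesis using nd indepD[OF ind] by blast
  qed
  \<comment> \<open>With determinant 0, the rows of the adjugate are relations between the rows of
    the Gram matrix. By \<open>rad\<close> they vanish, so the Gram matrix is 0 and the coefficients
    1, 0 give a relation too.\<close>
  have "\<sigma> v v = 0 \<and> - \<sigma> u v = 0" "\<sigma> v u = 0 \<and> - \<sigma> u u = 0"
    by (rule rad; use det in \<open>simp add: algebra_simps\<close>)+
  then have "(1 :: 'a) = 0 \<and> (0 :: 'a) = 0" by (intro rad) auto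
  then show False by simp
qed

lemma canonical_representative_exists:
  fixes scale :: "'a::field \<Rightarrow> 'v::ab_group_add \<Rightarrow> 'v"
  assumes two: "(2 :: 'a) \<noteq> 0" and R: "alpha4_representatives R" and pair: "assoc_form_pair scale m \<sigma>"
  shows "\<exists>(A, S)\<in>canonical_pairs R. pairs_isomorphic scale m \<sigma> (*s) (sc_mult A) (gram_form S)"
proof -
  interpret two_dim_algebra scale m
    using pair by (auto simp: assoc_form_pair_def two_dim_algebra_def two_dim_algebra_axioms_def two_dim_assoc_algebra_def)
  obtain A u v where A: "A \<in> assoc_types" "indep u v" "has_table scale m A u v"
    using ex_table[OF two] pair by (auto simp: assoc_form_pair_def)
  have nd: "nondegenerate_bilinear_form scale \<sigma>" using pair by (simp add: assoc_form_pair_def)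
  define T where "T = mat22 (\<sigma> u u) (\<sigma> u v) (\<sigma> v u) (\<sigma> v v)"
  have iso: "pairs_isomorphic (*s) (sc_mult A) (gram_form T) scale m \<sigma>"
    using nd by (intro frame_pairs_isomorphic[OF vector_space_axioms bilinear_mult _ bij_frame[OF A(2)] A(3) T_def])
      (simp add: nondegenerate_bilinear_form_def)
  obtain B S where BS: "(B, S) \<in> canonical_pairs R" and iso': "iso_cart A T B S"
    using canonical_pair_exists[OF two R A(1), of T] gram_det_nonzero[OF nd A(2)] by (auto simp: T_def)
  have "pairs_isomorphic scale m \<sigma> (*s) (sc_mult B) (gram_form S)"
    by (rule pairs_isomorphic_trans[OF pairs_isomorphic_sym[OF iso] iso'])
  with BS show ?thesis by blast
qed

theorem lemma3p1:
  fixes R :: "'a::field set"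
  assumes "CHAR('a) \<noteq> 2" and "CHAR('a) \<noteq> 3"
    and "alpha4_representatives R"
  shows "(\<forall>(A, S) \<in> canonical_pairs R. assoc_form_pair (*s) (sc_mult A) (gram_form S))
    \<and> (\<forall>(scale :: 'a \<Rightarrow> 'v::ab_group_add \<Rightarrow> 'v) mult \<sigma>.
          assoc_form_pair scale mult \<sigma> \<longrightarrow>
          (\<exists>(A, S) \<in> canonical_pairs R.
             pairs_isomorphic scale mult \<sigma> (*s) (sc_mult A) (gram_form S)))
    \<and> (\<forall>(A, S) \<in> canonical_pairs R. \<forall>(B, T) \<in> canonical_pairs R.
          pairs_isomorphic (*s) (sc_mult A) (gram_form S) (*s) (sc_mult B) (gram_form T) \<longleftrightarrow>
          equivclp identified (A, S) (B, T))"
proof -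
  \<comment> \<open>A characteristic dividing 2 is 1 or 2, and a field does not have characteristic
    1.\<close>
  have two: "(2 :: 'a) \<noteq> 0"
  proof
    assume "(2 :: 'a) = 0"
    then have "CHAR('a) dvd 2" using of_nat_eq_0_iff_char_dvd[of 2, where 'a = 'a] by simp
    then have "CHAR('a) = 1 \<or> CHAR('a) = 2" using two_is_prime_nat by (auto simp: prime_nat_iff)
    with assms(1) CHAR_not_1[where 'a = 'a] show False by simp
  qed
  show ?thesis
    using assoc_form_pair_cart[OF two canonical_pairsD]
      canonical_representative_exists[OF two assms(3)]
      equivclp_identified_imp_iso[OF two] iso_imp_equivclp_identified[OF two assms(3)]
    by blast
qed

end
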